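(* Let $\mathcal{A}$ be a von Neumann algebra with centre $\mathcal{Z}(\mathcal{A})$. A consistent family of projections $\Phi$ of $\mathcal{A}$ arises from a central projection (that is, $\Phi = \Phi_z$ for some central projection $z$ of $\mathcal{A}$) if and only if $\Phi$ is an invariant family of projections. Consequently, the maps $z \longmapsto \Phi_z$ and $\Phi \longmapsto \Phi(\mathcal{Z}(\mathcal{A}))$ define a bijective correspondence (they are mutually inverse) between the central projections of $\mathcal{A}$ and the invariant families of projections of $\mathcal{A}$.
   Context: All algebras and subalgebras are unital (subalgebras contain the unit of the ambient algebra). Let $\mathcal{A}$ be a von Neumann algebra. A consistent family of projections of $\mathcal{A}$ is a map $\Phi$ that assigns to each commutative sub-von-Neumann-algebra $V$ of $\mathcal{A}$ a projection $\Phi(V)$ in $V$ such that, for any commutative sub-von-Neumann-algebras $V \subset V'$ of $\mathcal{A}$, $\Phi(V)$ is the largest projection in $V$ which is less than or equal to $\Phi(V')$, i.e. $\Phi(V) = \sup\{ q \text{ is a projection in } V \mid q \leq \Phi(V') \}$. An invariant family of projections of $\mathcal{A}$ is a consistent family of projections $\Phi$ of $\mathcal{A}$ which further satisfies $\Phi(uVu^* ) = u\Phi(V)u^*$ for every commutative sub-von-Neumann-algebra $V$ of $\mathcal{A}$ and every unitary $u \in \mathcal{A}$. For a projection $p \in \mathcal{A}$, $\Phi_p$ denotes the consistent family of projections for which $\Phi_p(V)$ is the largest projection in $V$ which is less than or equal to $p$. A central projection is a projection in $\mathcal{Z}(\mathcal{A})$. *)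

theory Defs
  imports "HOL-Analysis.Analysis" "HOL-Library.Nonpos_Ints"
begin

section \<open>Complex Hilbert spaces\<close>

text \<open>The complex inner product is conjugate-linear in its first argument. Norm, metric and
  topology are those of the underlying real inner product space, whose inner product is
  \<open>Re (cinner x y)\<close>; positive definiteness of \<open>cinner\<close> is inherited from \<open>real_inner\<close>.\<close>

class complex_inner = real_inner +
  fixes scaleC :: "complex \<Rightarrow> 'a \<Rightarrow> 'a" (infixr \<open>*\<^sub>C\<close> 75)
    and cinner :: "'a \<Rightarrow> 'a \<Rightarrow> complex"
  assumes scaleC_of_real: "complex_of_real r *\<^sub>C x = r *\<^sub>R x"
    and scaleC_add_right: "c *\<^sub>C (x + y) = c *\<^sub>C x + c *\<^sub>C y"
    and scaleC_add_left: "(c + d) *\<^sub>C x = c *\<^sub>C x + d *\<^sub>C x"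
    and scaleC_scaleC: "c *\<^sub>C (d *\<^sub>C x) = (c * d) *\<^sub>C x"
    and cinner_commute: "cinner x y = cnj (cinner y x)"
    and cinner_add_left: "cinner (x + y) z = cinner x z + cinner y z"
    and cinner_scaleC_left: "cinner (c *\<^sub>C x) y = cnj c * cinner x y"
    and inner_eq_Re_cinner: "inner x y = Re (cinner x y)"

class complex_hilbert = complex_inner + complete_space


section \<open>Bounded operators\<close>

definition bounded_clinear :: "('h::complex_hilbert \<Rightarrow> 'h) \<Rightarrow> bool" where
  "bounded_clinear T \<longleftrightarrow> bounded_linear T \<and> (\<forall>c x. T (c *\<^sub>C x) = c *\<^sub>C T x)"

definition adj :: "('h::complex_hilbert \<Rightarrow> 'h) \<Rightarrow> ('h \<Rightarrow> 'h)" where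
  "adj T = (THE S. bounded_clinear S \<and> (\<forall>x y. cinner (T x) y = cinner x (S y)))"

definition unitary_op :: "('h::complex_hilbert \<Rightarrow> 'h) \<Rightarrow> bool" where
  "unitary_op u \<longleftrightarrow> bounded_clinear u \<and> adj u \<circ> u = id \<and> u \<circ> adj u = id"

definition projections :: "('h::complex_hilbert \<Rightarrow> 'h) set \<Rightarrow> ('h \<Rightarrow> 'h) set" where
  "projections V = {p \<in> V. bounded_clinear p \<and> p \<circ> p = p \<and> adj p = p}"

definition positive_op :: "('h::complex_hilbert \<Rightarrow> 'h) \<Rightarrow> bool" where
  "positive_op T \<longleftrightarrow> bounded_clinear T \<and> (\<forall>x. cinner x (T x) \<in> \<real>\<^sub>\<ge>\<^sub>0)"

definition op_le :: "('h::complex_hilbert \<Rightarrow> 'h) \<Rightarrow> ('h \<Rightarrow> 'h) \<Rightarrow> bool" (infix \<open>\<preceq>\<close> 50) where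
  "S \<preceq> T \<longleftrightarrow> positive_op (\<lambda>x. T x - S x)"


section \<open>Von Neumann algebras\<close>

definition commutant :: "('h::complex_hilbert \<Rightarrow> 'h) set \<Rightarrow> ('h \<Rightarrow> 'h) set" where
  "commutant X = {T. bounded_clinear T \<and> (\<forall>S\<in>X. T \<circ> S = S \<circ> T)}"

definition unital_star_subalgebra :: "('h::complex_hilbert \<Rightarrow> 'h) set \<Rightarrow> bool" where
  "unital_star_subalgebra A \<longleftrightarrow>
     (\<forall>T\<in>A. bounded_clinear T) \<and>
     id \<in> A \<and>
     (\<forall>S\<in>A. \<forall>T\<in>A. (\<lambda>x. S x + T x) \<in> A) \<and>
     (\<forall>c. \<forall>T\<in>A. (\<lambda>x. c *\<^sub>C T x) \<in> A) \<and>
     (\<forall>S\<in>A. \<forall>T\<in>A. S \<circ> T \<in> A) \<and>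
     (\<forall>T\<in>A. adj T \<in> A)"

text \<open>Von Neumann algebras are taken concretely, as algebras of operators on a Hilbert space,
  with Dixmier's definition: a self-adjoint algebra of bounded operators which is
  its own bicommutant.\<close>

definition von_neumann_algebra :: "('h::complex_hilbert \<Rightarrow> 'h) set \<Rightarrow> bool" where
  "von_neumann_algebra A \<longleftrightarrow> unital_star_subalgebra A \<and> commutant (commutant A) = A"

definition centre :: "('h::complex_hilbert \<Rightarrow> 'h) set \<Rightarrow> ('h \<Rightarrow> 'h) set" where
  "centre A = {T \<in> A. \<forall>S\<in>A. T \<circ> S = S \<circ> T}"

definition comm_subalgebras :: "('h::complex_hilbert \<Rightarrow> 'h) set \<Rightarrow> ('h \<Rightarrow> 'h) set set" where
  "comm_subalgebras A =
     {V. V \<subseteq> A \<and> von_neumann_algebra V \<and> (\<forall>S\<in>V. \<forall>T\<in>V. S \<circ> T = T \<circ> S)}"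


section \<open>Families of projections\<close>

definition is_largest_projection_below ::
    "('h::complex_hilbert \<Rightarrow> 'h) set \<Rightarrow> ('h \<Rightarrow> 'h) \<Rightarrow> ('h \<Rightarrow> 'h) \<Rightarrow> bool" where
  "is_largest_projection_below V p q \<longleftrightarrow>
     q \<in> projections V \<and> q \<preceq> p \<and> (\<forall>r\<in>projections V. r \<preceq> p \<longrightarrow> r \<preceq> q)"

text \<open>Families are extensional functions on \<open>comm_subalgebras A\<close> (equal to \<open>undefined\<close>
  elsewhere), so that equality in HOL is equality of families.\<close>

definition consistent_family ::
    "('h::complex_hilbert \<Rightarrow> 'h) set \<Rightarrow> (('h \<Rightarrow> 'h) set \<Rightarrow> ('h \<Rightarrow> 'h)) \<Rightarrow> bool" where
  "consistent_family A \<Phi> \<longleftrightarrow>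
     \<Phi> \<in> (\<Pi>\<^sub>E V\<in>comm_subalgebras A. projections V) \<and>
     (\<forall>V\<in>comm_subalgebras A. \<forall>V'\<in>comm_subalgebras A.
        V \<subseteq> V' \<longrightarrow> is_largest_projection_below V (\<Phi> V') (\<Phi> V))"

definition invariant_family ::
    "('h::complex_hilbert \<Rightarrow> 'h) set \<Rightarrow> (('h \<Rightarrow> 'h) set \<Rightarrow> ('h \<Rightarrow> 'h)) \<Rightarrow> bool" where
  "invariant_family A \<Phi> \<longleftrightarrow>
     consistent_family A \<Phi> \<and>
     (\<forall>V\<in>comm_subalgebras A. \<forall>u\<in>A. unitary_op u \<longrightarrow>
        \<Phi> ((\<lambda>T. u \<circ> T \<circ> adj u) ` V) = u \<circ> \<Phi> V \<circ> adj u)"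

definition induced_family ::
    "('h::complex_hilbert \<Rightarrow> 'h) set \<Rightarrow> ('h \<Rightarrow> 'h) \<Rightarrow> (('h \<Rightarrow> 'h) set \<Rightarrow> ('h \<Rightarrow> 'h))" where
  "induced_family A p = (\<lambda>V\<in>comm_subalgebras A. THE q. is_largest_projection_below V p q)"

end

theory Submission
  imports Defs
begin

text \<open>Let \<open>\<Phi>\<close> be an invariant family. The projections \<open>q\<close> with \<open>q \<le> \<Phi> V\<close> for some, equivalently
  every, \<open>V\<close> containing \<open>q\<close> form a set which is closed under subprojections, under unitary
  conjugation, and under suprema of commuting subsets. By Zorn's lemma such a \<open>q\<close> lies below a
  member \<open>e\<close> of this set that has no nonzero member orthogonal to it. If \<open>e\<close> were not
  central, some unitary of \<open>A\<close> would carry a nonzero subprojection of \<open>e\<close> into the complement of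
  \<open>e\<close>, contradicting maximality. Hence \<open>q \<le> e \<le> \<Phi> (centre A)\<close>. Applied to \<open>\<Phi> V\<close> for \<open>V\<close>
  containing the centre this gives \<open>\<Phi> V = \<Phi> (centre A)\<close>, and consistency determines all other
  values.\<close>

section \<open>Hilbert space preliminaries\<close>

\<comment> \<open>Two dominated projections that do not commute lie in no common commutative
  subalgebra, so consistency says nothing directly about their supremum. This is why Zorn's lemma
  runs over commuting sets, and why the resulting \<open>e\<close> is maximal only in the weak sense
  that no nonzero dominated projection is orthogonal to it. The usual source of the moving unitary
  is comparison theory: a partial isometry between equivalent subprojections of \<open>e\<close> and
  \<open>1 - e\<close>, extended to a unitary. Here the geometry of two projections takes its place.
  A self-adjoint \<open>a\<close> that fails to commute with \<open>e\<close> has a nonzero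
  off-diagonal part \<open>y\<close>. If \<open>T\<^sup>2 = y\<^sup>2\<close>, the closed range of
  \<open>T + y\<close> lies at 45 degrees to the range of \<open>e\<close>, and the reflection in it
  exchanges a part of \<open>e\<close> with a part of \<open>1 - e\<close>. The only functional
  calculus this takes is a square root of \<open>y\<^sup>2\<close> that commutes with whatever
  commutes with \<open>y\<^sup>2\<close>.\<close>
subclass (in complex_hilbert) banach ..

lemma cinner_scaleC_right: "cinner x (c *\<^sub>C y) = c * cinner x (y::'a::complex_inner)"
  by (metis cinner_commute cinner_scaleC_left complex_cnj_mult complex_cnj_cnj)

lemma Im_cinner: "Im (cinner x y) = inner (\<i> *\<^sub>C x) (y::'a::complex_inner)"
  by (simp add: inner_eq_Re_cinner cinner_scaleC_left)

lemma norm_scaleC: "norm (c *\<^sub>C x) = cmod c * norm (x::'a::complex_inner)"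
proof -
  have "cinner (c *\<^sub>C x) (c *\<^sub>C x) = (cnj c * c) * cinner x x"
    by (simp only: cinner_scaleC_left cinner_scaleC_right mult.assoc mult.left_commute)
  then have "(norm (c *\<^sub>C x))\<^sup>2 = Re ((cnj c * c) * cinner x x)"
    by (simp only: power2_norm_eq_inner inner_eq_Re_cinner)
  also have "cnj c * c = of_real ((cmod c)\<^sup>2)"
    by (metis complex_norm_square mult.commute of_real_power)
  also have "Re (of_real ((cmod c)\<^sup>2) * cinner x x) = (cmod c * norm x)\<^sup>2"
    by (simp add: power2_norm_eq_inner inner_eq_Re_cinner power_mult_distrib)
  finally show ?thesis by simp
qed

lemma bounded_linear_scaleC: "bounded_linear (\<lambda>x::'a::complex_inner. c *\<^sub>C x)"
proof (rule bounded_linear_intro)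
  show "c *\<^sub>C (r *\<^sub>R x) = r *\<^sub>R (c *\<^sub>C x)" for r and x :: 'a
    by (metis scaleC_of_real scaleC_scaleC mult.commute)
  show "norm (c *\<^sub>C x) \<le> norm x * cmod c" for x :: 'a
    by (simp add: norm_scaleC)
qed (rule scaleC_add_right)

text \<open>Minimises the distance from \<open>x\<close> to \<open>M\<close>. The sets of
  near-minimisers are closed and nested, and the parallelogram law shrinks their diameters, so
  completeness yields a common point. Working over the reals makes it serve real functionals as well
  as complex subspaces.\<close>

lemma orthogonal_decomposition:
  fixes M :: "'a::{real_inner,complete_space} set"
  assumes "closed M" "subspace M"
  obtains m where "m \<in> M" "\<And>y. y \<in> M \<Longrightarrow> inner (x - m) y = 0"
proof -
  define D where "D = (INF m\<in>M. (norm (x - m))\<^sup>2)"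
  have bdd: "bdd_below ((\<lambda>m. (norm (x - m))\<^sup>2) ` M)"
    by (rule bdd_belowI[of _ 0]) auto
  have D_le: "D \<le> (norm (x - m))\<^sup>2" if "m \<in> M" for m
    unfolding D_def by (rule cINF_lower[OF bdd that])
  define S where "S = (\<lambda>n. M \<inter> {m. (norm (x - m))\<^sup>2 \<le> D + 1 / real (Suc n)})"
  obtain m where m: "\<And>n. m \<in> S n"
  proof (rule decreasing_closed_nest[of S])
    show "closed (S n)" for n
      unfolding S_def by (intro closed_Int assms(1) closed_Collect_le continuous_intros)
    show "S n \<noteq> {}" for n
    proof -
      have "D < D + 1 / real (Suc n)" by simp
      then obtain m where "m \<in> M" "(norm (x - m))\<^sup>2 < D + 1 / real (Suc n)"
        using cINF_less_iff[OF _ bdd] subspace_0[OF assms(2)] unfolding D_def by blast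
      then show ?thesis unfolding S_def by (auto intro!: less_imp_le)
    qed
    show "S n \<subseteq> S m" if "m \<le> n" for m n
    proof -
      have "1 / real (Suc n) \<le> 1 / real (Suc m)"
        using that by (simp add: frac_le)
      then show ?thesis unfolding S_def by force
    qed
    show "\<exists>n. \<forall>a\<in>S n. \<forall>b\<in>S n. dist a b < e" if "e > 0" for e
    proof -
      \<comment> \<open>The parallelogram law bounds the squared distance of two points of
        \<open>S n\<close> by \<open>4 / Suc n\<close>; hence \<open>e\<^sup>2 / 4\<close>.\<close>
      obtain n where n: "inverse (real (Suc n)) < e\<^sup>2 / 4"
        using reals_Archimedean[of "e\<^sup>2 / 4"] \<open>e > 0\<close> by auto
      have "dist a b < e" if "a \<in> S n" "b \<in> S n" for a b
      proof -
        have "(1/2) *\<^sub>R (a + b) \<in> M"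
          using that assms(2) unfolding S_def by (auto intro: subspace_add subspace_scale)
        from D_le[OF this] have mid: "D \<le> (norm (x - (1/2) *\<^sub>R (a + b)))\<^sup>2" .
        have "(norm (a - b))\<^sup>2 = 2 * (norm (x - a))\<^sup>2 + 2 * (norm (x - b))\<^sup>2
            - 4 * (norm (x - (1/2) *\<^sub>R (a + b)))\<^sup>2"
          by (simp add: power2_norm_eq_inner inner_diff_left inner_diff_right inner_add_left
              inner_add_right inner_commute algebra_simps)
        also have "\<dots> \<le> 4 * (1 / real (Suc n))"
        proof -
          have "(norm (x - a))\<^sup>2 \<le> D + 1 / real (Suc n)" "(norm (x - b))\<^sup>2 \<le> D + 1 / real (Suc n)"
            using that unfolding S_def by blast+
          then show ?thesis using mid by linarith
        qed
        also have "\<dots> < e\<^sup>2" using n by (simp only: inverse_eq_divide)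
        finally show ?thesis
          using \<open>e > 0\<close> by (simp add: dist_norm power2_less_imp_less)
      qed
      then show ?thesis by blast
    qed
  qed blast
  then have mM: "m \<in> M" unfolding S_def by blast
  have "(norm (x - m))\<^sup>2 \<le> D"
  proof (rule field_le_epsilon)
    fix e :: real assume "e > 0"
    then obtain n where "inverse (real (Suc n)) < e" using reals_Archimedean by blast
    then show "(norm (x - m))\<^sup>2 \<le> D + e"
      using m[of n] unfolding S_def by (auto simp: inverse_eq_divide)
  qed
  then have min: "(norm (x - m))\<^sup>2 \<le> (norm (x - m'))\<^sup>2" if "m' \<in> M" for m'
    using D_le[OF that] order_trans by blast
  have "inner (x - m) y = 0" if "y \<in> M" for y
  proof (cases "y = 0")
    case False
    \<comment> \<open>The value of \<open>t\<close> that minimises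
      \<open>norm (x - m - t *\<^sub>R y)\<close>. Minimality of \<open>m\<close> then forces the
      gain, \<open>(inner (x - m) y)\<^sup>2 / (norm y)\<^sup>2\<close>, to vanish.\<close>
    define t where "t = inner (x - m) y / (norm y)\<^sup>2"
    have "m + t *\<^sub>R y \<in> M" using mM that assms(2) by (simp add: subspace_add subspace_scale)
    from min[OF this] have "0 \<le> (norm (x - m - t *\<^sub>R y))\<^sup>2 - (norm (x - m))\<^sup>2"
      by (simp add: algebra_simps)
    also have "\<dots> = t\<^sup>2 * (norm y)\<^sup>2 - 2 * t * inner (x - m) y"
      unfolding power2_norm_eq_inner inner_diff_left[of "x - m"] inner_diff_right[of _ "x - m"]
      by (simp add: inner_commute power2_eq_square)
    also have "\<dots> = - (inner (x - m) y)\<^sup>2 / (norm y)\<^sup>2"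
      using False by (simp add: t_def field_simps power2_eq_square)
    finally have "(inner (x - m) y)\<^sup>2 \<le> 0"
      using False by (simp add: divide_le_0_iff zero_le_divide_iff)
    then show ?thesis by simp
  qed simp
  then show ?thesis using mM that by blast
qed

text \<open>The component \<open>w\<close> of \<open>x\<close> orthogonal to the kernel represents
  \<open>f\<close> up to a factor, because \<open>y - (f y / f x) *\<^sub>R w\<close> lies in the
  kernel for every \<open>y\<close>.\<close>

lemma riesz_representation:
  fixes f :: "'a::{real_inner,complete_space} \<Rightarrow> real"
  assumes "bounded_linear f"
  obtains v where "\<And>x. f x = inner x v"
proof (cases "\<forall>x. f x = 0")
  case True
  then show ?thesis using that[of 0] by simp
next
  case False
  interpret f: bounded_linear f by fact
  obtain x where x: "f x \<noteq> 0" using False by blast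
  have "closed {y. f y = 0}"
    by (intro closed_Collect_eq continuous_intros f.continuous_on)
  moreover have "subspace {y. f y = 0}"
    by (auto simp: subspace_def f.add f.scaleR)
  ultimately obtain m where m: "f m = 0" "\<And>y. f y = 0 \<Longrightarrow> inner (x - m) y = 0"
    by (rule orthogonal_decomposition[of _ x]) auto
  define w where "w = x - m"
  have fw: "f w = f x" using m(1) by (simp add: w_def f.diff)
  have "w \<noteq> 0" using fw x by auto
  have "f y = inner y ((f x / (norm w)\<^sup>2) *\<^sub>R w)" for y
  proof -
    have "f (y - (f y / f x) *\<^sub>R w) = 0" using x fw by (simp add: f.diff f.scaleR)
    from m(2)[OF this] have "inner w y = (f y / f x) * (norm w)\<^sup>2"
      by (simp add: w_def[symmetric] inner_diff_right power2_norm_eq_inner)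
    then show ?thesis using \<open>w \<noteq> 0\<close> x by (simp add: inner_commute[of y w])
  qed
  then show ?thesis using that by blast
qed


section \<open>Bounded operators and adjoints\<close>

lemma bounded_clinearD: "bounded_clinear T \<Longrightarrow> bounded_linear T"
  by (simp add: bounded_clinear_def)

lemma bounded_clinear_simps:
  assumes "bounded_clinear T"
  shows "T (x + y) = T x + T y" "T (x - y) = T x - T y" "T (r *\<^sub>R x) = r *\<^sub>R T x"
    "T (c *\<^sub>C x) = c *\<^sub>C T x" "T 0 = 0" "T (- x) = - T x"
proof -
  interpret bounded_linear T using assms by (rule bounded_clinearD)
  show "T (x + y) = T x + T y" "T (x - y) = T x - T y" "T (r *\<^sub>R x) = r *\<^sub>R T x"
    "T 0 = 0" "T (- x) = - T x"
    by (rule add diff scaleR zero neg)+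
  show "T (c *\<^sub>C x) = c *\<^sub>C T x" using assms by (simp add: bounded_clinear_def)
qed

lemma scaleC_diff_right: "c *\<^sub>C (x - y) = c *\<^sub>C x - c *\<^sub>C (y::'a::complex_inner)"
  using linear_diff[OF bounded_linear.linear[OF bounded_linear_scaleC]] .

lemma scaleC_zero_right: "c *\<^sub>C 0 = (0::'a::complex_inner)"
  using linear_0[OF bounded_linear.linear[OF bounded_linear_scaleC]] .

lemma scaleC_one: "1 *\<^sub>C x = (x::'a::complex_inner)"
  using scaleC_of_real[of 1 x] by simp

lemma bounded_clinear_id: "bounded_clinear id"
  by (simp add: bounded_clinear_def id_def)

lemma bounded_clinear_comp:
  "bounded_clinear S \<Longrightarrow> bounded_clinear T \<Longrightarrow> bounded_clinear (S \<circ> T)"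
  unfolding bounded_clinear_def comp_def using bounded_linear_compose by auto

lemma bounded_clinear_add:
  "bounded_clinear S \<Longrightarrow> bounded_clinear T \<Longrightarrow> bounded_clinear (\<lambda>x. S x + T x)"
  unfolding bounded_clinear_def by (auto intro: bounded_linear_add simp: scaleC_add_right)

lemma bounded_clinear_diff:
  "bounded_clinear S \<Longrightarrow> bounded_clinear T \<Longrightarrow> bounded_clinear (\<lambda>x. S x - T x)"
  unfolding bounded_clinear_def by (auto intro: bounded_linear_sub simp: scaleC_diff_right)

lemma bounded_clinear_scaleC:
  "bounded_clinear T \<Longrightarrow> bounded_clinear (\<lambda>x. c *\<^sub>C T x)"
  unfolding bounded_clinear_def
  by (auto intro: bounded_linear_compose[OF bounded_linear_scaleC]
      simp: scaleC_scaleC mult.commute)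

text \<open>An imaginary part of \<open>cinner\<close> is a real inner product with the first
  argument multiplied by \<open>\<i>\<close>, so complex linearity of \<open>T\<close> upgrades a
  real adjunction to a complex one. This lets later work with adjoints stay with
  \<open>inner\<close>.\<close>

lemma cinner_eq_if_inner_eq:
  assumes "bounded_clinear T" "\<And>x y. inner (T x) y = inner x (S y)"
  shows "cinner (T x) y = cinner x (S y)"
proof (rule complex_eqI)
  show "Re (cinner (T x) y) = Re (cinner x (S y))"
    using assms(2)[of x y] by (simp add: inner_eq_Re_cinner)
  have "inner (\<i> *\<^sub>C T x) y = inner (\<i> *\<^sub>C x) (S y)"
    using assms(2)[of "\<i> *\<^sub>C x" y] by (simp add: bounded_clinear_simps[OF assms(1)])
  then show "Im (cinner (T x) y) = Im (cinner x (S y))" by (simp add: Im_cinner)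
qed

lemma inner_eq_if_cinner_eq: "cinner a b = cinner c d \<Longrightarrow> inner a b = inner c d"
  by (simp add: inner_eq_Re_cinner)

lemma adjI:
  assumes "bounded_clinear T" "bounded_clinear S" "\<And>x y. inner (T x) y = inner x (S y)"
  shows "adj T = S"
  unfolding adj_def
proof (rule the_equality)
  show "bounded_clinear S \<and> (\<forall>x y. cinner (T x) y = cinner x (S y))"
    using cinner_eq_if_inner_eq[OF assms(1,3)] assms(2) by blast
next
  fix S' assume S': "bounded_clinear S' \<and> (\<forall>x y. cinner (T x) y = cinner x (S' y))"
  have "inner x (S' y) = inner x (S y)" for x y
    using S' assms(3) by (metis inner_eq_if_cinner_eq)
  then show "S' = S" by (metis vector_eq_ldot ext)
qed

lemma adjoint_exists:
  fixes T :: "'h::complex_hilbert \<Rightarrow> 'h"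
  assumes "bounded_clinear T"
  obtains S where "bounded_clinear S" "\<And>x y. inner (T x) y = inner x (S y)"
proof -
  interpret T: bounded_linear T using assms by (rule bounded_clinearD)
  have "\<exists>v. \<forall>x. inner (T x) y = inner x v" for y
    using riesz_representation[OF bounded_linear_compose[OF bounded_linear_inner_left
          T.bounded_linear_axioms], of y]
    by metis
  then obtain S where S: "\<And>x y. inner (T x) y = inner x (S y)" by metis
  have eqI: "a = b" if "\<And>x. inner x a = inner x b" for a b :: 'h
    using that by (metis vector_eq_ldot)
  obtain K where K: "\<And>x. norm (T x) \<le> norm x * K" using T.bounded by blast
  have bl: "bounded_linear S"
  proof (rule bounded_linear_intro)
    show "S (x + y) = S x + S y" for x y
      by (rule eqI) (simp add: S[symmetric] inner_add_right)
    show "S (r *\<^sub>R x) = r *\<^sub>R S x" for r x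
      by (rule eqI) (simp add: S[symmetric])
    show "norm (S y) \<le> norm y * K" for y
    proof (cases "S y = 0")
      case True
      have "0 \<le> norm (T y)" by simp
      also have "\<dots> \<le> norm y * K" by (rule K)
      finally show ?thesis using True by simp
    next
      case False
      have "norm (S y) * norm (S y) = inner (T (S y)) y"
        by (simp add: S power2_norm_eq_inner[symmetric] power2_eq_square)
      also have "\<dots> \<le> norm (T (S y)) * norm y" by (rule norm_cauchy_schwarz)
      also have "\<dots> \<le> norm (S y) * K * norm y" by (intro mult_right_mono K) simp
      finally have "norm (S y) * norm (S y) \<le> norm (S y) * (norm y * K)"
        by (simp add: ac_simps)
      then show ?thesis using False by simp
    qed
  qed
  \<comment> \<open>The real Riesz representation gives real linearity only; complex homogeneity
    comes from the complex form of the adjunction.\<close>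
  have "S (c *\<^sub>C y) = c *\<^sub>C S y" for c y
  proof (rule eqI)
    fix x
    have "cinner (T x) (c *\<^sub>C y) = cinner x (c *\<^sub>C S y)"
      using cinner_eq_if_inner_eq[OF assms S] by (simp add: cinner_scaleC_right)
    then have "inner (T x) (c *\<^sub>C y) = inner x (c *\<^sub>C S y)" by (rule inner_eq_if_cinner_eq)
    then show "inner x (S (c *\<^sub>C y)) = inner x (c *\<^sub>C S y)" by (simp add: S)
  qed
  then have "bounded_clinear S" using bl by (simp add: bounded_clinear_def)
  then show ?thesis using S that by blast
qed

lemma
  assumes "bounded_clinear T"
  shows bounded_clinear_adj: "bounded_clinear (adj T)"
    and inner_adj_right: "inner x (adj T y) = inner (T x) y"
    and inner_adj_left: "inner (adj T x) y = inner x (T y)"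
proof -
  obtain S where S: "bounded_clinear S" "\<And>x y. inner (T x) y = inner x (S y)"
    using adjoint_exists[OF assms] by blast
  from adjI[OF assms S] have "adj T = S" .
  then show "bounded_clinear (adj T)" "inner x (adj T y) = inner (T x) y"
    "inner (adj T x) y = inner x (T y)"
    using S by (simp_all add: inner_commute)
qed

lemma adj_adj: "bounded_clinear T \<Longrightarrow> adj (adj T) = T"
  by (rule adjI) (simp_all add: bounded_clinear_adj inner_adj_left)

lemma adj_comp:
  "bounded_clinear S \<Longrightarrow> bounded_clinear T \<Longrightarrow> adj (S \<circ> T) = adj T \<circ> adj S"
  by (rule adjI) (simp_all add: bounded_clinear_comp bounded_clinear_adj inner_adj_right)

lemma inner_self_adjoint:
  "bounded_clinear T \<Longrightarrow> adj T = T \<Longrightarrow> inner (T x) y = inner x (T y)"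
  by (metis inner_adj_right)


section \<open>Square roots of squares of self-adjoint operators\<close>

text \<open>With \<open>B = 1 - c\<^sup>-\<^sup>2 Y\<^sup>2\<close>, a contraction, the root is \<open>c (1 - R)\<close> where \<open>R\<close> solves
  \<open>R = (B + R\<^sup>2) / 2\<close>. The iteration from \<open>0\<close> converges in norm, its increments being dominated
  by those of the increasing scalar iteration \<open>r \<mapsto> (1 + r\<^sup>2) / 2\<close>.\<close>

lemma square_root_of_square:
  fixes Y :: "'h::complex_hilbert \<Rightarrow> 'h"
  assumes Y: "bounded_clinear Y" "adj Y = Y"
  shows "\<exists>T. bounded_clinear T \<and> adj T = T \<and> (\<forall>x. T (T x) = Y (Y x)) \<and>
    (\<forall>S. bounded_linear S \<longrightarrow> (\<forall>x. S (Y (Y x)) = Y (Y (S x))) \<longrightarrow> (\<forall>x. S (T x) = T (S x)))"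
proof -
  interpret Y: bounded_linear Y using Y(1) by (rule bounded_clinearD)
  obtain c where c: "c > 0" "\<And>x. norm (Y x) \<le> norm x * c" using Y.pos_bounded by blast
  \<comment> \<open>With \<open>t * c\<^sup>2 = 1\<close> the quadratic term of
    \<open>(norm (B x))\<^sup>2\<close> cancels one of the two cross terms, leaving at most
    \<open>(norm x)\<^sup>2 - t * (norm (Y x))\<^sup>2\<close>.\<close>
  define t where "t = 1 / c\<^sup>2"
  have t: "t \<ge> 0" "t * c\<^sup>2 = 1" using c(1) by (simp_all add: t_def)
  define B where "B = Blinfun (\<lambda>x. x - t *\<^sub>R Y (Y x))"
  have "bounded_linear (\<lambda>x. x - t *\<^sub>R Y (Y x))"
    by (intro bounded_linear_sub bounded_linear_ident bounded_linear_scaleR_right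
        bounded_linear_compose[OF bounded_linear_scaleR_right]
        bounded_linear_compose[OF Y.bounded_linear_axioms] Y.bounded_linear_axioms)
  then have B: "blinfun_apply B x = x - t *\<^sub>R Y (Y x)" for x
    unfolding B_def by (simp add: bounded_linear_Blinfun_apply)
  have normB: "norm B \<le> 1"
  proof (rule norm_blinfun_bound)
    fix x
    have "norm (Y (Y x)) \<le> norm (Y x) * c" by (rule c)
    then have "(norm (Y (Y x)))\<^sup>2 \<le> (norm (Y x) * c)\<^sup>2" by (simp add: power_mono)
    then have YY: "inner (Y (Y x)) (Y (Y x)) \<le> c\<^sup>2 * inner (Y x) (Y x)"
      by (simp add: power2_norm_eq_inner[symmetric] power_mult_distrib mult.commute)
    have sa: "inner x (Y (Y x)) = inner (Y x) (Y x)" "inner (Y (Y x)) x = inner (Y x) (Y x)"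
      using inner_self_adjoint[OF Y, of x "Y x"] inner_self_adjoint[OF Y, of "Y x" x] by simp_all
    have "(norm (blinfun_apply B x))\<^sup>2
        = inner x x - 2 * t * inner (Y x) (Y x) + t\<^sup>2 * inner (Y (Y x)) (Y (Y x))"
      unfolding power2_norm_eq_inner B inner_diff_left inner_diff_right inner_scaleR_left
        inner_scaleR_right sa by (simp add: power2_eq_square algebra_simps)
    also have "\<dots> \<le> inner x x - 2 * t * inner (Y x) (Y x) + t\<^sup>2 * (c\<^sup>2 * inner (Y x) (Y x))"
      using mult_left_mono[OF YY, of "t\<^sup>2"] by simp
    also have "t\<^sup>2 * (c\<^sup>2 * inner (Y x) (Y x)) = t * (t * c\<^sup>2) * inner (Y x) (Y x)"
      by (simp only: power2_eq_square mult_ac)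
    also have "\<dots> = t * inner (Y x) (Y x)" by (simp only: t mult_1_right)
    also have "inner x x - 2 * t * inner (Y x) (Y x) + t * inner (Y x) (Y x) \<le> (norm x)\<^sup>2"
      using mult_nonneg_nonneg[OF t(1) inner_ge_zero[of "Y x"]]
      unfolding power2_norm_eq_inner by linarith
    finally have "norm (blinfun_apply B x) \<le> norm x" by (rule power2_le_imp_le) simp
    then show "norm (blinfun_apply B x) \<le> 1 * norm x" by simp
  qed simp
  define R where "R = rec_nat 0 (\<lambda>_ R. (1/2) *\<^sub>R (B + (R o\<^sub>L R)))"
  have R0: "R 0 = 0" and RS: "R (Suc n) = (1/2) *\<^sub>R (B + (R n o\<^sub>L R n))" for n
    by (simp_all add: R_def)
  define r :: "nat \<Rightarrow> real" where "r = rec_nat 0 (\<lambda>_ r. (1 + r\<^sup>2) / 2)"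
  have r0: "r 0 = 0" and rS: "r (Suc n) = (1 + (r n)\<^sup>2) / 2" for n
    by (simp_all add: r_def)
  have r: "0 \<le> r n \<and> r n \<le> 1" for n
  proof (induction n)
    case (Suc n)
    then have "(r n)\<^sup>2 \<le> 1" by (simp add: abs_square_le_1)
    then show ?case by (simp add: rS)
  qed (simp add: r0)
  have "incseq r"
  proof (rule incseq_SucI)
    fix n
    have "0 \<le> (r n - 1)\<^sup>2" by simp
    then show "r n \<le> r (Suc n)" by (simp add: rS power2_diff)
  qed
  have normR: "norm (R n) \<le> r n" for n
  proof (induction n)
    case (Suc n)
    have "norm (R n o\<^sub>L R n) \<le> norm (R n) * norm (R n)" by (rule norm_blinfun_compose)
    also have "\<dots> \<le> r n * r n" using Suc r by (intro mult_mono) auto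
    finally have "norm (B + (R n o\<^sub>L R n)) \<le> 1 + (r n)\<^sup>2"
      using normB norm_triangle_ineq[of B "R n o\<^sub>L R n"] by (simp add: power2_eq_square)
    then show ?case by (simp add: RS rS)
  qed (simp add: R0 r0)
  \<comment> \<open>The convergence of \<open>r\<close> comes with no geometric rate, so increments
    are compared directly: \<open>a\<^sup>2 - b\<^sup>2 = a (a - b) + (a - b) b\<close> holds for
    operators and for scalars alike.\<close>
  have diffR: "norm (R (m + k) - R m) \<le> r (m + k) - r m" for m k
  proof (induction m)
    case 0
    then show ?case using normR by (simp add: R0 r0)
  next
    case (Suc m)
    let ?a = "R (m + k)" and ?b = "R m"
    have "R (Suc m + k) - R (Suc m) = (1/2) *\<^sub>R ((?a o\<^sub>L (?a - ?b)) + ((?a - ?b) o\<^sub>L ?b))"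
      by (rule blinfun_eqI)
        (simp add: RS plus_blinfun.rep_eq minus_blinfun.rep_eq scaleR_blinfun.rep_eq
          blinfun.diff_right algebra_simps)
    also have "norm \<dots> \<le> (1/2) * (norm ?a * norm (?a - ?b) + norm (?a - ?b) * norm ?b)"
      using norm_triangle_ineq[of "?a o\<^sub>L (?a - ?b)" "(?a - ?b) o\<^sub>L ?b"]
        norm_blinfun_compose[of ?a "?a - ?b"] norm_blinfun_compose[of "?a - ?b" ?b]
      by simp
    also have "\<dots> \<le> (1/2) * (r (m+k) * (r (m+k) - r m) + (r (m+k) - r m) * r m)"
      using Suc normR r order_trans[OF norm_ge_zero Suc]
      by (intro mult_left_mono add_mono mult_mono) auto
    also have "\<dots> = r (Suc m + k) - r (Suc m)"
      by (simp add: rS power2_eq_square algebra_simps diff_divide_distrib)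
    finally show ?case .
  qed
  have "Cauchy R"
  proof (rule metric_CauchyI)
    fix e :: real assume "e > 0"
    have "convergent r"
      using incseq_convergent[OF \<open>incseq r\<close>, of 1] r convergentI by metis
    from metric_CauchyD[OF convergent_Cauchy[OF this] \<open>e > 0\<close>]
    obtain N where N: "\<And>m n. m \<ge> N \<Longrightarrow> n \<ge> N \<Longrightarrow> dist (r m) (r n) < e"
      by blast
    have *: "dist (R n) (R m) < e" if "N \<le> m" "m \<le> n" for m n
      using diffR[of m "n - m"] N[of n m] that by (simp add: dist_norm)
    show "\<exists>N. \<forall>m\<ge>N. \<forall>n\<ge>N. dist (R m) (R n) < e"
      by (metis * dist_commute nle_le)
  qed
  then obtain L where L: "R \<longlonglongrightarrow> L" using Cauchy_convergent convergent_def by blast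
  have "(\<lambda>n. R (Suc n)) \<longlonglongrightarrow> (1/2) *\<^sub>R (B + (L o\<^sub>L L))"
    unfolding RS
    by (intro tendsto_intros bounded_bilinear.tendsto[OF bounded_bilinear_blinfun_compose] L)
  then have "L = (1/2) *\<^sub>R (B + (L o\<^sub>L L))"
    by (rule LIMSEQ_unique[OF LIMSEQ_Suc[OF L]])
  from arg_cong[OF this, of "\<lambda>l. 2 *\<^sub>R blinfun_apply l _"]
  have fixp: "2 *\<^sub>R blinfun_apply L x = blinfun_apply B x + blinfun_apply L (blinfun_apply L x)" for x
    by (simp add: plus_blinfun.rep_eq scaleR_blinfun.rep_eq)
  have Lx: "(\<lambda>n. blinfun_apply (R n) x) \<longlonglongrightarrow> blinfun_apply L x" for x
    by (intro blinfun.tendsto L tendsto_const)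
  define T where "T = (\<lambda>x. c *\<^sub>R (x - blinfun_apply L x))"
  \<comment> \<open>The fixed point equation says
    \<open>(1 - L)\<^sup>2 = 1 - 2L + L\<^sup>2 = 1 - B\<close>, which is
    \<open>Y\<^sup>2 / c\<^sup>2\<close>.\<close>
  have TT: "T (T x) = Y (Y x)" for x
  proof -
    have "T (T x) = c\<^sup>2 *\<^sub>R (x - 2 *\<^sub>R blinfun_apply L x + blinfun_apply L (blinfun_apply L x))"
      by (simp add: T_def blinfun.diff_right blinfun.scaleR_right algebra_simps power2_eq_square
          scaleR_2)
    also have "\<dots> = c\<^sup>2 *\<^sub>R (x - blinfun_apply B x)" by (simp add: fixp)
    also have "\<dots> = Y (Y x)" using t by (simp add: B mult.commute)
    finally show ?thesis .
  qed
  have comm: "S (T x) = T (S x)"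
    if S: "bounded_linear S" and SY: "\<And>x. S (Y (Y x)) = Y (Y (S x))" for S x
  proof -
    interpret S: bounded_linear S by fact
    have "S (blinfun_apply (R n) x) = blinfun_apply (R n) (S x)" for n x
    proof (induction n arbitrary: x)
      case (Suc n)
      then show ?case
        by (simp add: RS plus_blinfun.rep_eq scaleR_blinfun.rep_eq S.scaleR S.add B S.diff SY)
    qed (simp add: R0 S.zero zero_blinfun.rep_eq)
    then have "(\<lambda>n. S (blinfun_apply (R n) x)) \<longlonglongrightarrow> blinfun_apply L (S x)"
      using Lx by simp
    moreover have "(\<lambda>n. S (blinfun_apply (R n) x)) \<longlonglongrightarrow> S (blinfun_apply L x)"
      by (intro S.tendsto Lx)
    ultimately have "S (blinfun_apply L x) = blinfun_apply L (S x)"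
      using LIMSEQ_unique by blast
    then show ?thesis by (simp add: T_def S.scaleR S.diff)
  qed
  have bT: "bounded_linear T"
    unfolding T_def
    by (intro bounded_linear_compose[OF bounded_linear_scaleR_right] bounded_linear_sub
        bounded_linear_ident blinfun.bounded_linear_right)
  \<comment> \<open>Multiplication by a complex scalar is a bounded real-linear map commuting with
    \<open>Y\<^sup>2\<close>, so complex linearity of \<open>T\<close> is an instance of
    \<open>comm\<close>.\<close>
  have cT: "bounded_clinear T"
    unfolding bounded_clinear_def
    using bT comm[OF bounded_linear_scaleC] by (simp add: bounded_clinear_simps[OF Y(1)])
  have "inner (blinfun_apply (R n) x) y = inner x (blinfun_apply (R n) y)" for n x y
  proof (induction n arbitrary: x y)
    case (Suc n)
    then show ?case
      by (simp add: RS plus_blinfun.rep_eq scaleR_blinfun.rep_eq inner_add_left inner_add_right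
          B inner_diff_left inner_diff_right inner_self_adjoint[OF Y])
  qed (simp add: R0 zero_blinfun.rep_eq)
  then have "(\<lambda>n. inner (blinfun_apply (R n) x) y) \<longlonglongrightarrow> inner x (blinfun_apply L y)" for x y
    using tendsto_inner[OF tendsto_const Lx, of x y] by simp
  then have "inner (blinfun_apply L x) y = inner x (blinfun_apply L y)" for x y
    using LIMSEQ_unique tendsto_inner[OF Lx tendsto_const] by blast
  then have "inner (T x) y = inner x (T y)" for x y
    by (simp add: T_def inner_diff_left inner_diff_right)
  then have "adj T = T" by (intro adjI cT)
  then show ?thesis using cT TT comm by blast
qed


section \<open>Projections\<close>

lemma projections_iff: "p \<in> projections V \<longleftrightarrow> p \<in> V \<and> p \<in> projections UNIV"
  by (auto simp: projections_def)

lemma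
  assumes "p \<in> projections V"
  shows projection_bounded: "bounded_clinear p"
    and projection_idem: "p (p x) = p x"
    and inner_projection: "inner (p x) y = inner x (p y)"
    and projection_UNIV: "p \<in> projections UNIV"
    and projection_mem: "p \<in> V"
  using assms by (auto simp: projections_def fun_eq_iff inner_self_adjoint)

lemma projectionI:
  assumes "bounded_clinear p" "\<And>x. p (p x) = p x" "\<And>x y. inner (p x) y = inner x (p y)"
  shows "p \<in> projections UNIV"
  using assms adjI[OF assms(1,1,3)] by (auto simp: projections_def)

lemma projection_complement:
  assumes "p \<in> projections UNIV"
  shows "(\<lambda>x. x - p x) \<in> projections UNIV"
proof (rule projectionI)
  note p = projection_bounded[OF assms] projection_idem[OF assms] inner_projection[OF assms]
  show "bounded_clinear (\<lambda>x. x - p x)"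
    using bounded_clinear_diff[OF bounded_clinear_id p(1)] by simp
  show "x - p x - p (x - p x) = x - p x" for x
    by (simp add: bounded_clinear_simps[OF p(1)] p(2))
  show "inner (x - p x) y = inner x (y - p y)" for x y
    by (simp add: inner_diff_left inner_diff_right p(3))
qed

lemma positive_op_projection:
  assumes "p \<in> projections UNIV"
  shows "positive_op p"
proof -
  note p = projection_bounded[OF assms] projection_idem[OF assms] inner_projection[OF assms]
  have "Im (cinner z z) = 0" for z :: 'a
    using arg_cong[OF cinner_commute[of z z], of Im] by simp
  moreover have "Im (cinner x (p x)) = Im (cinner (p x) (p x))" for x
    using p(3)[of "\<i> *\<^sub>C x" "p x"] by (simp add: Im_cinner bounded_clinear_simps[OF p(1)] p(2))
  moreover have "Re (cinner x (p x)) = inner (p x) (p x)" for x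
    using p(3)[of x "p x"] by (simp add: inner_eq_Re_cinner p(2))
  ultimately show ?thesis
    by (simp add: positive_op_def p(1) complex_nonneg_Reals_iff)
qed

text \<open>The equations \<open>qp = p\<close> and \<open>pq = p\<close> are adjoint to each
  other.\<close>

lemma projection_absorb:
  assumes "p \<in> projections UNIV" "q \<in> projections UNIV"
  shows "(\<forall>x. q (p x) = p x) \<longleftrightarrow> (\<forall>x. p (q x) = p x)"
proof -
  have eqI: "a = b" if "\<And>z. inner z a = inner z b" for a b :: 'a
    using that by (metis vector_eq_ldot)
  have "p (q x) = p x" if "\<forall>x. q (p x) = p x" for x
    using that by (intro eqI) (metis assms inner_projection)
  moreover have "q (p x) = p x" if "\<forall>x. p (q x) = p x" for x
    using that by (intro eqI) (metis assms inner_projection)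
  ultimately show ?thesis by blast
qed

text \<open>Replaces the operator inequality by an equation, the form in which the order is used
  from here on. For \<open>z\<close> in the range of \<open>p\<close>,
  \<open>inner z z \<le> inner z (q z) = inner (q z) (q z)\<close>, which forces
  \<open>z = q z\<close>. Conversely \<open>qp = p\<close> makes \<open>q - p\<close> a projection,
  hence positive.\<close>

lemma projection_le_iff:
  assumes p: "p \<in> projections UNIV" and q: "q \<in> projections UNIV"
  shows "p \<preceq> q \<longleftrightarrow> (\<forall>x. q (p x) = p x)"
proof
  assume le: "p \<preceq> q"
  show "\<forall>x. q (p x) = p x"
  proof
    fix x
    define z where "z = p x"
    have "p z = z" using projection_idem[OF p] by (simp add: z_def)
    have "0 \<le> Re (cinner z (q z - p z))"
      using le by (simp add: op_le_def positive_op_def complex_nonneg_Reals_iff)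
    then have "inner z z \<le> inner z (q z)"
      by (simp add: inner_eq_Re_cinner[symmetric] \<open>p z = z\<close> inner_diff_right)
    moreover have "inner (q z) (q z) = inner z (q z)"
      using inner_projection[OF q] projection_idem[OF q] by metis
    ultimately have "inner (z - q z) (z - q z) \<le> 0"
      by (simp add: inner_diff_left inner_diff_right inner_commute[of "q z" z])
    then have "inner (z - q z) (z - q z) = 0"
      using inner_ge_zero[of "z - q z"] by linarith
    then show "q (p x) = p x" by (simp add: z_def)
  qed
next
  assume qp: "\<forall>x. q (p x) = p x"
  then have pq: "\<forall>x. p (q x) = p x" using projection_absorb[OF p q] by blast
  have "(\<lambda>x. q x - p x) \<in> projections UNIV"
  proof (rule projectionI)
    show "bounded_clinear (\<lambda>x. q x - p x)"
      using bounded_clinear_diff p q projection_bounded by blast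
    show "q (q x - p x) - p (q x - p x) = q x - p x" for x
      using pq qp by (simp add: bounded_clinear_simps[OF projection_bounded[OF p]]
          bounded_clinear_simps[OF projection_bounded[OF q]] projection_idem[OF p] projection_idem[OF q])
    show "inner (q x - p x) y = inner x (q y - p y)" for x y
      by (simp add: inner_diff_left inner_diff_right inner_projection[OF p] inner_projection[OF q])
  qed
  then show "p \<preceq> q" unfolding op_le_def by (rule positive_op_projection)
qed

lemma projection_le_iff':
  assumes "p \<in> projections UNIV" "q \<in> projections UNIV"
  shows "p \<preceq> q \<longleftrightarrow> (\<forall>x. p (q x) = p x)"
  using projection_le_iff[OF assms] projection_absorb[OF assms] by simp

lemma projection_le_refl: "p \<in> projections UNIV \<Longrightarrow> p \<preceq> p"
  by (simp add: projection_le_iff projection_idem)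

lemma projection_le_trans:
  assumes "p \<in> projections UNIV" "q \<in> projections UNIV" "r \<in> projections UNIV" "p \<preceq> q" "q \<preceq> r"
  shows "p \<preceq> r"
proof -
  have "q (p x) = p x" "r (q x) = q x" for x
    using assms by (simp_all add: projection_le_iff)
  then have "r (p x) = p x" for x by metis
  then show ?thesis using assms by (simp add: projection_le_iff)
qed

lemma projection_le_antisym:
  assumes "p \<in> projections UNIV" "q \<in> projections UNIV" "p \<preceq> q" "q \<preceq> p"
  shows "p = q"
proof
  fix x
  have "q (p x) = p x" using assms by (simp add: projection_le_iff)
  moreover have "q (p x) = q x" using assms by (simp add: projection_le_iff'[of q p])
  ultimately show "p x = q x" by simp
qed


section \<open>Commutants and von Neumann algebras\<close>

lemma commutantI:
  "bounded_clinear T \<Longrightarrow> (\<And>S x. S \<in> X \<Longrightarrow> T (S x) = S (T x)) \<Longrightarrow> T \<in> commutant X"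
  by (auto simp: commutant_def fun_eq_iff)

lemma commutantD: "T \<in> commutant X \<Longrightarrow> S \<in> X \<Longrightarrow> T (S x) = S (T x)"
  by (auto simp: commutant_def fun_eq_iff)

lemma commutant_bounded: "T \<in> commutant X \<Longrightarrow> bounded_clinear T"
  by (simp add: commutant_def)

lemma commutant_antimono: "X \<subseteq> Y \<Longrightarrow> commutant Y \<subseteq> commutant X"
  by (auto simp: commutant_def)

lemma subset_bicommutant:
  assumes "\<And>T. T \<in> X \<Longrightarrow> bounded_clinear T"
  shows "X \<subseteq> commutant (commutant X)"
proof
  fix T assume "T \<in> X"
  with assms show "T \<in> commutant (commutant X)"
    by (intro commutantI) (simp_all add: commutantD[of _ X T])
qed

lemma commutant_bicommutant:
  assumes "\<And>T. T \<in> X \<Longrightarrow> bounded_clinear T"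
  shows "commutant (commutant (commutant X)) = commutant X"
proof
  show "commutant (commutant (commutant X)) \<subseteq> commutant X"
    by (intro commutant_antimono subset_bicommutant assms)
  show "commutant X \<subseteq> commutant (commutant (commutant X))"
    by (intro subset_bicommutant) (rule commutant_bounded)
qed

lemma adj_mem_commutant:
  assumes X: "\<And>T. T \<in> X \<Longrightarrow> bounded_clinear T" "\<And>T. T \<in> X \<Longrightarrow> adj T \<in> X"
    and T: "T \<in> commutant X"
  shows "adj T \<in> commutant X"
proof (rule commutantI)
  have bT: "bounded_clinear T" using T by (rule commutant_bounded)
  then show "bounded_clinear (adj T)" by (rule bounded_clinear_adj)
  fix S x assume S: "S \<in> X"
  have "T \<circ> adj S = adj S \<circ> T" using commutantD[OF T X(2)[OF S]] by (simp add: fun_eq_iff)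
  then have "adj (T \<circ> adj S) = adj (adj S \<circ> T)" by simp
  then have "S \<circ> adj T = adj T \<circ> S"
    using S X bT by (simp add: adj_comp adj_adj bounded_clinear_adj)
  then show "adj T (S x) = S (adj T x)" by (simp add: fun_eq_iff)
qed

text \<open>Centres, generated algebras and unitary conjugates are all recognised as von Neumann
  algebras by writing them as commutants of sets closed under \<open>adj\<close>.\<close>

lemma von_neumann_algebra_commutant:
  assumes X: "\<And>T. T \<in> X \<Longrightarrow> bounded_clinear T" "\<And>T. T \<in> X \<Longrightarrow> adj T \<in> X"
  shows "von_neumann_algebra (commutant X)"
  unfolding von_neumann_algebra_def unital_star_subalgebra_def
proof (intro conjI ballI allI)
  show "commutant (commutant (commutant X)) = commutant X"
    using X(1) by (rule commutant_bicommutant)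
  show "bounded_clinear T" if "T \<in> commutant X" for T using that by (rule commutant_bounded)
  show "id \<in> commutant X" by (simp add: commutantI bounded_clinear_id)
  show "(\<lambda>x. S x + T x) \<in> commutant X" if "S \<in> commutant X" "T \<in> commutant X" for S T
    using that X(1)
    by (intro commutantI bounded_clinear_add)
      (auto simp: commutant_bounded commutantD bounded_clinear_simps)
  show "(\<lambda>x. c *\<^sub>C T x) \<in> commutant X" if "T \<in> commutant X" for c T
    using that X(1)
    by (intro commutantI bounded_clinear_scaleC)
      (auto simp: commutant_bounded commutantD bounded_clinear_simps)
  show "S \<circ> T \<in> commutant X" if "S \<in> commutant X" "T \<in> commutant X" for S T
    using that by (intro commutantI bounded_clinear_comp) (auto simp: commutant_bounded commutantD)
  show "adj T \<in> commutant X" if "T \<in> commutant X" for T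
    using X that by (rule adj_mem_commutant)
qed

lemma
  assumes "von_neumann_algebra A"
  shows vna_bounded: "T \<in> A \<Longrightarrow> bounded_clinear T"
    and vna_id: "id \<in> A"
    and vna_add: "S \<in> A \<Longrightarrow> T \<in> A \<Longrightarrow> (\<lambda>x. S x + T x) \<in> A"
    and vna_scaleC: "T \<in> A \<Longrightarrow> (\<lambda>x. c *\<^sub>C T x) \<in> A"
    and vna_comp: "S \<in> A \<Longrightarrow> T \<in> A \<Longrightarrow> S \<circ> T \<in> A"
    and vna_adj: "T \<in> A \<Longrightarrow> adj T \<in> A"
    and vna_bicommutant: "commutant (commutant A) = A"
  using assms by (auto simp: von_neumann_algebra_def unital_star_subalgebra_def)

lemma vna_scaleR: "von_neumann_algebra A \<Longrightarrow> T \<in> A \<Longrightarrow> (\<lambda>x. r *\<^sub>R T x) \<in> A"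
  using vna_scaleC[of A T "complex_of_real r"] by (simp add: scaleC_of_real)

lemma vna_diff:
  assumes "von_neumann_algebra A" "S \<in> A" "T \<in> A"
  shows "(\<lambda>x. S x - T x) \<in> A"
  using vna_add[OF assms(1,2) vna_scaleR[OF assms(1,3), of "-1"]] by simp

lemma von_neumann_algebra_centre:
  assumes "von_neumann_algebra A"
  shows "von_neumann_algebra (centre A)"
proof -
  have "centre A = commutant (A \<union> commutant A)"
  proof -
    have "commutant (A \<union> commutant A) = commutant A \<inter> commutant (commutant A)"
      unfolding commutant_def by blast
    also have "\<dots> = commutant A \<inter> A" by (simp add: vna_bicommutant[OF assms])
    also have "\<dots> = centre A"
      using assms vna_bounded[OF assms]
      by (auto simp: vna_bicommutant centre_def commutant_def)
    finally show ?thesis ..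
  qed
  moreover have "von_neumann_algebra (commutant (A \<union> commutant A))"
  proof (rule von_neumann_algebra_commutant)
    note b = vna_bounded[OF assms]
    show "bounded_clinear T" if "T \<in> A \<union> commutant A" for T
      using that b commutant_bounded by blast
    show "adj T \<in> A \<union> commutant A" if "T \<in> A \<union> commutant A" for T
      using that vna_adj[OF assms] adj_mem_commutant[OF b vna_adj[OF assms]] by blast
  qed
  ultimately show ?thesis by simp
qed

lemma centre_mem_comm_subalgebras:
  "von_neumann_algebra A \<Longrightarrow> centre A \<in> comm_subalgebras A"
  using von_neumann_algebra_centre unfolding comm_subalgebras_def centre_def by blast

lemma comm_subalgebrasD:
  assumes "V \<in> comm_subalgebras A"
  shows "V \<subseteq> A" "von_neumann_algebra V" "\<And>S T. S \<in> V \<Longrightarrow> T \<in> V \<Longrightarrow> S \<circ> T = T \<circ> S"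
  using assms by (simp_all add: comm_subalgebras_def)

text \<open>Taking commutants reverses inclusions: \<open>X \<subseteq> A\<close> puts the
  bicommutant of \<open>X\<close> inside that of \<open>A\<close>, which is \<open>A\<close>, and
  \<open>X \<subseteq> commutant X\<close> puts it inside \<open>commutant X\<close>, which makes it
  commutative.\<close>

lemma generated_comm_subalgebra:
  assumes A: "von_neumann_algebra A" and X: "X \<subseteq> A" "\<And>T. T \<in> X \<Longrightarrow> adj T \<in> X"
    and comm: "\<And>S T. S \<in> X \<Longrightarrow> T \<in> X \<Longrightarrow> S \<circ> T = T \<circ> S"
  shows "commutant (commutant X) \<in> comm_subalgebras A" "X \<subseteq> commutant (commutant X)"
proof -
  have b: "bounded_clinear T" if "T \<in> X" for T using that X(1) vna_bounded[OF A] by blast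
  show sub: "X \<subseteq> commutant (commutant X)" using b by (rule subset_bicommutant)
  have "commutant (commutant X) \<subseteq> commutant (commutant A)"
    by (intro commutant_antimono X)
  then have "commutant (commutant X) \<subseteq> A" by (simp add: vna_bicommutant[OF A])
  moreover have "von_neumann_algebra (commutant (commutant X))"
  proof (rule von_neumann_algebra_commutant)
    show "bounded_clinear T" if "T \<in> commutant X" for T using that by (rule commutant_bounded)
    show "adj T \<in> commutant X" if "T \<in> commutant X" for T
      using b X(2) that by (rule adj_mem_commutant)
  qed
  moreover have "S \<circ> T = T \<circ> S" if "S \<in> commutant (commutant X)" "T \<in> commutant (commutant X)" for S T
  proof -
    have "X \<subseteq> commutant X" using b comm by (auto simp: commutant_def)
    then have "commutant (commutant X) \<subseteq> commutant X" by (rule commutant_antimono)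
    then have "T \<in> commutant X" using that by blast
    then show ?thesis using commutantD[OF that(1)] by (simp add: fun_eq_iff)
  qed
  ultimately show "commutant (commutant X) \<in> comm_subalgebras A"
    by (simp add: comm_subalgebras_def)
qed

lemma generated_comm_subalgebra_projections:
  assumes "von_neumann_algebra A" "X \<subseteq> projections A"
    "\<And>S T. S \<in> X \<Longrightarrow> T \<in> X \<Longrightarrow> S \<circ> T = T \<circ> S"
  shows "commutant (commutant X) \<in> comm_subalgebras A" "X \<subseteq> commutant (commutant X)"
proof -
  have "X \<subseteq> A" "\<And>T. T \<in> X \<Longrightarrow> adj T \<in> X"
    using assms(2) unfolding projections_def by auto
  then show "commutant (commutant X) \<in> comm_subalgebras A" "X \<subseteq> commutant (commutant X)"
    using generated_comm_subalgebra[OF assms(1) _ _ assms(3)] by blast+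
qed

section \<open>Projections in a von Neumann algebra: kernels, suprema, largest projections\<close>

lemma inner_scaleC_left: "inner (c *\<^sub>C x) y = inner x (cnj c *\<^sub>C (y::'a::complex_inner))"
  by (simp add: inner_eq_Re_cinner cinner_scaleC_left cinner_scaleC_right)

text \<open>The commutant of \<open>A\<close> is closed under \<open>adj\<close>, so the orthogonal
  complement of \<open>M\<close> is invariant along with \<open>M\<close>. The projection therefore
  commutes with the commutant and lies in the bicommutant, which is \<open>A\<close>.\<close>

lemma projection_onto_invariant_subspace:
  assumes A: "von_neumann_algebra A" and M: "closed M" "0 \<in> M"
    "\<And>x y. x \<in> M \<Longrightarrow> y \<in> M \<Longrightarrow> x + y \<in> M" "\<And>c x. x \<in> M \<Longrightarrow> c *\<^sub>C x \<in> M"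
    and inv: "\<And>T x. T \<in> commutant A \<Longrightarrow> x \<in> M \<Longrightarrow> T x \<in> M"
  obtains p where "p \<in> projections A" "\<And>x. p x = x \<longleftrightarrow> x \<in> M"
proof -
  have sub: "subspace M"
    using M by (auto simp: subspace_def scaleC_of_real[symmetric])
  have "\<exists>m. m \<in> M \<and> (\<forall>y\<in>M. inner (x - m) y = 0)" for x
    using orthogonal_decomposition[OF M(1) sub, of x] by metis
  then obtain p where p: "\<And>x. p x \<in> M" "\<And>x y. y \<in> M \<Longrightarrow> inner (x - p x) y = 0" by metis
  \<comment> \<open>Linearity of \<open>p\<close> and its commutation with \<open>T\<close> both
    reduce to this characterisation of \<open>p x\<close>.\<close>
  have uniq: "p x = m" if "m \<in> M" "\<And>y. y \<in> M \<Longrightarrow> inner (x - m) y = 0" for x m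
  proof -
    have "p x - m \<in> M" using sub p(1) that(1) by (rule subspace_diff)
    then have "inner (x - m) (p x - m) = 0" "inner (x - p x) (p x - m) = 0"
      using p(2) that(2) by blast+
    then have "inner (p x - m) (p x - m) = 0" by (simp add: inner_diff_left)
    then show ?thesis by simp
  qed
  have fixed: "p x = x \<longleftrightarrow> x \<in> M" for x using p(1) uniq by (metis diff_self inner_zero_left)
  have inner_p: "inner (p x) y = inner x y" if "y \<in> M" for x y
    using p(2)[OF that] by (simp add: inner_diff_left)
  have sa: "inner (p x) y = inner x (p y)" for x y
    using inner_p[OF p(1)] by (metis inner_commute)
  have "p (x + y) = p x + p y" for x y
    by (rule uniq) (simp_all add: M p(1) inner_p inner_diff_left inner_add_left)
  moreover have scaleC: "p (c *\<^sub>C x) = c *\<^sub>C p x" for c x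
    by (rule uniq) (simp_all add: M p(1) inner_p inner_diff_left inner_scaleC_left)
  moreover have "p (r *\<^sub>R x) = r *\<^sub>R p x" for r x
    using scaleC[of "complex_of_real r"] by (simp add: scaleC_of_real)
  moreover have "norm (p x) \<le> norm x * 1" for x
  proof (cases "p x = 0")
    case False
    have "norm (p x) * norm (p x) = inner x (p x)"
      using inner_p[OF p(1), of x x]
      by (simp add: power2_norm_eq_inner[symmetric] power2_eq_square)
    also have "\<dots> \<le> norm x * norm (p x)" by (rule norm_cauchy_schwarz)
    finally show ?thesis using False by simp
  qed simp
  ultimately have "bounded_linear p" by (intro bounded_linear_intro[of p 1])
  with scaleC have b: "bounded_clinear p" by (simp add: bounded_clinear_def)
  have "p \<in> commutant (commutant A)"
  proof (rule commutantI[OF b])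
    fix T x assume T: "T \<in> commutant A"
    then have bT: "bounded_clinear T" by (rule commutant_bounded)
    have adjT: "adj T \<in> commutant A"
      using adj_mem_commutant[OF _ _ T] vna_bounded[OF A] vna_adj[OF A] by blast
    have "inner (T x - T (p x)) y = 0" if "y \<in> M" for y
      using p(2)[OF inv[OF adjT that], of x]
      by (simp add: inner_adj_right[OF bT] bounded_clinear_simps[OF bT])
    then show "p (T x) = T (p x)" using inv[OF T p(1)] by (intro uniq) auto
  qed
  moreover have "p \<in> projections UNIV"
    using fixed p(1) by (intro projectionI b sa) blast
  ultimately have "p \<in> projections A"
    using vna_bicommutant[OF A] projections_iff by blast
  then show ?thesis using fixed that by blast
qed

text \<open>A common kernel of operators in \<open>A\<close> is invariant under the commutant of
  \<open>A\<close>. Suprema and the half-angle projection are both obtained as complements of such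
  kernel projections.\<close>

lemma kernel_projection:
  assumes A: "von_neumann_algebra A" and X: "X \<subseteq> A"
  obtains p where "p \<in> projections A" "\<And>x. p x = x \<longleftrightarrow> (\<forall>T\<in>X. T x = 0)"
proof -
  have b: "bounded_clinear T" if "T \<in> X" for T using that X vna_bounded[OF A] by blast
  have "closed {x. T x = 0}" if "T \<in> X" for T
    using linear_continuous_on[OF bounded_clinearD[OF b[OF that]]]
    by (intro closed_Collect_eq continuous_intros) auto
  then have "closed (\<Inter>T\<in>X. {x. T x = 0})" by blast
  moreover have "(\<Inter>T\<in>X. {x. T x = 0}) = {x. \<forall>T\<in>X. T x = 0}" by blast
  ultimately have closed: "closed {x. \<forall>T\<in>X. T x = 0}" by simp
  have inv: "T (S x) = 0" if "S \<in> commutant A" "T \<in> X" "T x = 0" for S T x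
    using commutantD[OF that(1), of T x] that X
      bounded_clinear_simps(5)[OF commutant_bounded[OF that(1)]] by auto
  show ?thesis
  proof (rule projection_onto_invariant_subspace[OF A, of "{x. \<forall>T\<in>X. T x = 0}"])
    fix p assume "p \<in> projections A" "\<And>x. p x = x \<longleftrightarrow> x \<in> {x. \<forall>T\<in>X. T x = 0}"
    then show ?thesis using that by simp
  qed (use closed inv in \<open>auto simp: b bounded_clinear_simps scaleC_zero_right\<close>)
qed

text \<open>The range of \<open>q\<close> is the orthogonal complement of the common kernel of
  \<open>X\<close>, that is, the closed span of the ranges. The last clause ranges over all
  projections on the space because largest projections in a subalgebra are taken below projections
  that may lie outside it.\<close>

lemma supremum_projection:
  assumes A: "von_neumann_algebra A" and X: "X \<subseteq> projections A"
  obtains q where "q \<in> projections A" "\<And>r. r \<in> X \<Longrightarrow> r \<preceq> q"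
    "\<And>p. p \<in> projections UNIV \<Longrightarrow> (\<And>r. r \<in> X \<Longrightarrow> r \<preceq> p) \<Longrightarrow> q \<preceq> p"
proof -
  have XU: "r \<in> projections UNIV" if "r \<in> X" for r using that X projection_UNIV by blast
  have "X \<subseteq> A" using X projection_mem by blast
  then obtain n where n: "n \<in> projections A" "\<And>x. n x = x \<longleftrightarrow> (\<forall>r\<in>X. r x = 0)"
    using kernel_projection[OF A] by blast
  define q where "q = (\<lambda>x. x - n x)"
  have qU: "q \<in> projections UNIV"
    unfolding q_def by (rule projection_complement[OF projection_UNIV[OF n(1)]])
  moreover have "q \<in> A"
    using vna_diff[OF A vna_id[OF A] projection_mem[OF n(1)]] by (simp add: q_def)
  ultimately have "q \<in> projections A" using projections_iff by blast
  moreover have "r \<preceq> q" if "r \<in> X" for r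
  proof -
    have "r (n x) = 0" for x using n(2)[of "n x"] projection_idem[OF n(1)] that by blast
    then show ?thesis
      using projection_le_iff'[OF XU[OF that] qU] projection_bounded[OF XU[OF that]]
      by (simp add: q_def bounded_clinear_simps)
  qed
  moreover have "q \<preceq> p" if p: "p \<in> projections UNIV" and le: "\<And>r. r \<in> X \<Longrightarrow> r \<preceq> p" for p
  proof -
    have "r (x - p x) = 0" if "r \<in> X" for r x
      using le[OF that] projection_le_iff'[OF XU[OF that] p] projection_bounded[OF XU[OF that]]
      by (simp add: bounded_clinear_simps)
    then have "n (x - p x) = x - p x" for x using n(2) by blast
    then have "q (x - p x) = 0" for x by (simp add: q_def)
    then show ?thesis
      using projection_le_iff'[OF qU p] projection_bounded[OF qU]
      by (simp add: bounded_clinear_simps)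
  qed
  ultimately show ?thesis using that by blast
qed

lemma largest_projection_exists:
  assumes "von_neumann_algebra V" "p \<in> projections UNIV"
  obtains q where "is_largest_projection_below V p q"
proof -
  have "{r \<in> projections V. r \<preceq> p} \<subseteq> projections V" by blast
  from supremum_projection[OF assms(1) this]
  obtain q where "q \<in> projections V" "\<And>r. r \<in> projections V \<Longrightarrow> r \<preceq> p \<Longrightarrow> r \<preceq> q" "q \<preceq> p"
    using assms(2) by (metis (mono_tags, lifting) mem_Collect_eq)
  then have "is_largest_projection_below V p q" by (simp add: is_largest_projection_below_def)
  then show ?thesis by (rule that)
qed

lemma largest_projection_unique:
  assumes "is_largest_projection_below V p q" "is_largest_projection_below V p q'"
  shows "q = q'"
proof -
  have "q \<in> projections UNIV" "q' \<in> projections UNIV" "q \<preceq> q'" "q' \<preceq> q"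
    using assms projection_UNIV unfolding is_largest_projection_below_def by blast+
  then show ?thesis by (rule projection_le_antisym)
qed

lemma induced_family_eq:
  assumes "V \<in> comm_subalgebras A" "is_largest_projection_below V p q"
  shows "induced_family A p V = q"
proof -
  have "(THE q. is_largest_projection_below V p q) = q"
    using assms(2) largest_projection_unique[OF _ assms(2)] by (rule the_equality)
  then show ?thesis using assms(1) by (simp add: induced_family_def)
qed

lemma induced_family_largest:
  assumes "V \<in> comm_subalgebras A" "p \<in> projections UNIV"
  shows "is_largest_projection_below V p (induced_family A p V)"
proof -
  obtain q where "is_largest_projection_below V p q"
    using largest_projection_exists[OF comm_subalgebrasD(2)[OF assms(1)] assms(2)] .
  then show ?thesis using induced_family_eq[OF assms(1)] by simp
qed


section \<open>Unitary conjugation\<close>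

abbreviation conjugate_op :: "('h::complex_hilbert \<Rightarrow> 'h) \<Rightarrow> ('h \<Rightarrow> 'h) \<Rightarrow> ('h \<Rightarrow> 'h)" where
  "conjugate_op u \<equiv> (\<lambda>T. u \<circ> T \<circ> adj u)"

lemma
  assumes "unitary_op u"
  shows unitary_bounded: "bounded_clinear u"
    and unitary_adj_bounded: "bounded_clinear (adj u)"
    and unitary_adj_left: "adj u (u x) = x"
    and unitary_adj_right: "u (adj u x) = x"
  using assms by (auto simp: unitary_op_def fun_eq_iff bounded_clinear_adj)

lemma unitary_op_adj: "unitary_op u \<Longrightarrow> unitary_op (adj u)"
  unfolding unitary_op_def by (simp add: adj_adj bounded_clinear_adj)

lemma conjugate_op_inverse:
  assumes "unitary_op u"
  shows "conjugate_op u (conjugate_op (adj u) T) = T"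
    and "conjugate_op (adj u) (conjugate_op u T) = T"
  using assms
  by (simp_all add: fun_eq_iff adj_adj unitary_bounded unitary_adj_left unitary_adj_right)

lemma adj_conjugate_op:
  assumes "unitary_op u" "bounded_clinear T"
  shows "adj (conjugate_op u T) = conjugate_op u (adj T)"
  using assms
  by (simp add: adj_comp adj_adj bounded_clinear_comp bounded_clinear_adj unitary_bounded comp_assoc)

lemma bounded_clinear_conjugate_op:
  "unitary_op u \<Longrightarrow> bounded_clinear T \<Longrightarrow> bounded_clinear (conjugate_op u T)"
  by (simp add: bounded_clinear_comp unitary_bounded unitary_adj_bounded)

lemma conjugate_projection:
  assumes u: "unitary_op u" and p: "p \<in> projections UNIV"
  shows "conjugate_op u p \<in> projections UNIV"
proof (rule projectionI)
  show "bounded_clinear (conjugate_op u p)"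
    by (rule bounded_clinear_conjugate_op[OF u projection_bounded[OF p]])
  show "conjugate_op u p (conjugate_op u p x) = conjugate_op u p x" for x
    by (simp add: unitary_adj_left[OF u] projection_idem[OF p])
  show "inner (conjugate_op u p x) y = inner x (conjugate_op u p y)" for x y
    by (simp add: inner_adj_right[OF unitary_bounded[OF u], symmetric]
        inner_adj_left[OF unitary_bounded[OF u], symmetric] inner_projection[OF p])
qed

lemma projections_conjugate:
  assumes u: "unitary_op u"
  shows "projections (conjugate_op u ` V) = conjugate_op u ` projections V"
proof
  show "conjugate_op u ` projections V \<subseteq> projections (conjugate_op u ` V)"
  proof clarify
    fix p assume p: "p \<in> projections V"
    have "conjugate_op u p \<in> projections UNIV" "conjugate_op u p \<in> conjugate_op u ` V"
      using conjugate_projection[OF u projection_UNIV[OF p]] projection_mem[OF p] by auto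
    then show "conjugate_op u p \<in> projections (conjugate_op u ` V)"
      by (subst projections_iff) simp
  qed
  show "projections (conjugate_op u ` V) \<subseteq> conjugate_op u ` projections V"
  proof
    fix p assume p: "p \<in> projections (conjugate_op u ` V)"
    then obtain T where T: "T \<in> V" "p = conjugate_op u T" using projection_mem by blast
    have "conjugate_op (adj u) p \<in> projections UNIV"
      by (rule conjugate_projection[OF unitary_op_adj[OF u] projection_UNIV[OF p]])
    then have "T \<in> projections UNIV" using T(2) by (simp only: conjugate_op_inverse(2)[OF u])
    then have "T \<in> projections V" using T(1) by (subst projections_iff) simp
    then show "p \<in> conjugate_op u ` projections V" using T by blast
  qed
qed

lemma conjugate_op_mono:
  assumes u: "unitary_op u" and p: "p \<in> projections UNIV" and q: "q \<in> projections UNIV"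
    and "p \<preceq> q"
  shows "conjugate_op u p \<preceq> conjugate_op u q"
  using assms
  by (simp add: projection_le_iff[OF p q] unitary_adj_left[OF u]
      projection_le_iff[OF conjugate_projection[OF u p] conjugate_projection[OF u q]])

lemma commutant_conjugate:
  assumes u: "unitary_op u"
  shows "commutant (conjugate_op u ` X) = conjugate_op u ` commutant X"
proof
  \<comment> \<open>One inclusion for every unitary \<open>v\<close>; its instance at
    \<open>adj u\<close>, transported back by \<open>u\<close>, is the reverse inclusion.\<close>
  have sub: "conjugate_op v ` commutant Y \<subseteq> commutant (conjugate_op v ` Y)"
    if v: "unitary_op v" for v :: "'a \<Rightarrow> 'a" and Y
  proof (clarify)
    fix T assume T: "T \<in> commutant Y"
    show "conjugate_op v T \<in> commutant (conjugate_op v ` Y)"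
    proof (rule commutantI)
      show "bounded_clinear (conjugate_op v T)"
        by (rule bounded_clinear_conjugate_op[OF v commutant_bounded[OF T]])
      fix S x assume "S \<in> conjugate_op v ` Y"
      then obtain S' where "S' \<in> Y" "S = conjugate_op v S'" by blast
      then show "conjugate_op v T (S x) = S (conjugate_op v T x)"
        using commutantD[OF T] by (simp add: unitary_adj_left[OF v])
    qed
  qed
  show "conjugate_op u ` commutant X \<subseteq> commutant (conjugate_op u ` X)" using sub[OF u] .
  have "conjugate_op (adj u) ` commutant (conjugate_op u ` X)
      \<subseteq> commutant (conjugate_op (adj u) ` conjugate_op u ` X)"
    using sub[OF unitary_op_adj[OF u]] .
  also have "conjugate_op (adj u) ` conjugate_op u ` X = X"
    by (simp only: image_image conjugate_op_inverse[OF u] image_ident)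
  finally have "conjugate_op u ` conjugate_op (adj u) ` commutant (conjugate_op u ` X)
      \<subseteq> conjugate_op u ` commutant X"
    by (rule image_mono)
  then show "commutant (conjugate_op u ` X) \<subseteq> conjugate_op u ` commutant X"
    by (simp only: image_image conjugate_op_inverse[OF u] image_ident)
qed

lemma von_neumann_algebra_conjugate:
  assumes u: "unitary_op u" and V: "von_neumann_algebra V"
  shows "von_neumann_algebra (conjugate_op u ` V)"
proof -
  have "conjugate_op u ` V = commutant (conjugate_op u ` commutant V)"
    by (simp only: commutant_conjugate[OF u] vna_bicommutant[OF V])
  moreover have "von_neumann_algebra (commutant (conjugate_op u ` commutant V))"
  proof (rule von_neumann_algebra_commutant)
    show "bounded_clinear T" if "T \<in> conjugate_op u ` commutant V" for T
      using that bounded_clinear_conjugate_op[OF u commutant_bounded] by blast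
    show "adj T \<in> conjugate_op u ` commutant V" if "T \<in> conjugate_op u ` commutant V" for T
    proof -
      from that obtain S where S: "S \<in> commutant V" "T = conjugate_op u S" by blast
      have "adj T = conjugate_op u (adj S)"
        using adj_conjugate_op[OF u commutant_bounded[OF S(1)]] S(2) by simp
      moreover have "adj S \<in> commutant V"
        using vna_bounded[OF V] vna_adj[OF V] S(1) by (rule adj_mem_commutant)
      ultimately show ?thesis by blast
    qed
  qed
  ultimately show ?thesis by simp
qed

lemma conjugate_comm_subalgebra:
  assumes A: "von_neumann_algebra A" and u: "u \<in> A" "unitary_op u" and V: "V \<in> comm_subalgebras A"
  shows "conjugate_op u ` V \<in> comm_subalgebras A"
proof -
  note V' = comm_subalgebrasD[OF V]
  have "conjugate_op u ` V \<subseteq> A"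
    using V'(1) u(1) vna_comp[OF A] vna_adj[OF A] by blast
  moreover have "conjugate_op u S \<circ> conjugate_op u T = conjugate_op u T \<circ> conjugate_op u S"
    if "S \<in> V" "T \<in> V" for S T
  proof -
    have "S (T x) = T (S x)" for x using V'(3)[OF that] by (simp add: fun_eq_iff)
    then show ?thesis by (simp add: fun_eq_iff unitary_adj_left[OF u(2)])
  qed
  ultimately show ?thesis
    using von_neumann_algebra_conjugate[OF u(2) V'(2)] unfolding comm_subalgebras_def by blast
qed

text \<open>Conjugation by \<open>u\<close> is an order isomorphism on projections, with conjugation
  by \<open>adj u\<close> as inverse.\<close>

lemma largest_projection_conjugate:
  assumes u: "unitary_op u" and p: "p \<in> projections UNIV"
    and q: "is_largest_projection_below V p q"
  shows "is_largest_projection_below (conjugate_op u ` V) (conjugate_op u p) (conjugate_op u q)"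
proof -
  have qV: "q \<in> projections V" and qp: "q \<preceq> p"
    and max: "\<And>r. r \<in> projections V \<Longrightarrow> r \<preceq> p \<Longrightarrow> r \<preceq> q"
    using q unfolding is_largest_projection_below_def by blast+
  have "conjugate_op u r \<preceq> conjugate_op u q"
    if r: "r \<in> projections V" and le: "conjugate_op u r \<preceq> conjugate_op u p" for r
  proof -
    have "conjugate_op (adj u) (conjugate_op u r) \<preceq> conjugate_op (adj u) (conjugate_op u p)"
      using unitary_op_adj[OF u] conjugate_projection[OF u projection_UNIV[OF r]]
        conjugate_projection[OF u p] le
      by (rule conjugate_op_mono)
    then have "r \<preceq> p" by (simp only: conjugate_op_inverse[OF u])
    from max[OF r this] show ?thesis
      by (rule conjugate_op_mono[OF u projection_UNIV[OF r] projection_UNIV[OF qV]])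
  qed
  moreover have "conjugate_op u q \<preceq> conjugate_op u p"
    using u projection_UNIV[OF qV] p qp by (rule conjugate_op_mono)
  ultimately show ?thesis
    using qV unfolding is_largest_projection_below_def projections_conjugate[OF u] by blast
qed


section \<open>Moving a non-central projection into its complement\<close>

text \<open>An \<open>e\<close> commuting with all self-adjoint elements commutes with
  \<open>S + adj S\<close> and with \<open>\<i>\<close> times \<open>S - adj S\<close>, and
  \<open>2 S\<close> is a complex combination of these two.\<close>

lemma noncommuting_self_adjoint:
  assumes A: "von_neumann_algebra A" and e: "e \<in> A" "e \<notin> centre A"
  obtains a x where "a \<in> A" "adj a = a" "e (a x) \<noteq> a (e x)"
proof (rule ccontr)
  assume "\<not> thesis"
  with that have comm: "\<And>a x. a \<in> A \<Longrightarrow> adj a = a \<Longrightarrow> e (a x) = a (e x)" by blast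
  have be: "bounded_clinear e" using vna_bounded[OF A e(1)] .
  have "e (S x) = S (e x)" if S: "S \<in> A" for S x
  proof -
    have bS: "bounded_clinear S" and baS: "bounded_clinear (adj S)"
      using vna_bounded[OF A S] bounded_clinear_adj by blast+
    let ?R = "\<lambda>x. S x + adj S x" and ?I = "\<lambda>x. \<i> *\<^sub>C (S x - adj S x)"
    have RA: "?R \<in> A" using vna_add[OF A S vna_adj[OF A S]] .
    have IA: "?I \<in> A" using vna_scaleC[OF A vna_diff[OF A S vna_adj[OF A S]]] .
    have adj_R: "adj ?R = ?R"
      by (rule adjI) (simp_all add: bounded_clinear_add bS baS inner_add_left inner_add_right
          inner_adj_left[OF bS] inner_adj_right[OF bS])
    have adj_I: "adj ?I = ?I"
    proof (rule adjI)
      show "bounded_clinear ?I" "bounded_clinear ?I"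
        by (intro bounded_clinear_scaleC bounded_clinear_diff bS baS)+
      show "inner (?I x) y = inner x (?I y)" for x y
      proof -
        have "inner (?I x) y = inner (S (\<i> *\<^sub>C x)) y - inner (adj S (\<i> *\<^sub>C x)) y"
          by (simp add: inner_diff_left scaleC_diff_right bounded_clinear_simps(4)[OF bS]
              bounded_clinear_simps(4)[OF baS])
        also have "\<dots> = inner (\<i> *\<^sub>C x) (adj S y - S y)"
          by (simp add: inner_adj_left[OF bS] inner_adj_right[OF bS] inner_diff_right)
        also have "\<dots> = inner x ((- \<i>) *\<^sub>C (adj S y - S y))"
          by (simp add: inner_scaleC_left)
        also have "(- \<i>) *\<^sub>C (adj S y - S y) = \<i> *\<^sub>C (- 1) *\<^sub>C (adj S y - S y)"
          by (simp add: scaleC_scaleC)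
        also have "(- 1) *\<^sub>C (adj S y - S y) = S y - adj S y"
          using scaleC_of_real[of "-1" "adj S y - S y"] by simp
        finally show ?thesis .
      qed
    qed
    have R: "e (?R x) = ?R (e x)" using comm[OF RA adj_R] .
    have "e (?I x) = ?I (e x)" using comm[OF IA adj_I] .
    then have "\<i> *\<^sub>C e (S x - adj S x) = \<i> *\<^sub>C (S (e x) - adj S (e x))"
      by (simp only: bounded_clinear_simps(4)[OF be])
    then have "(- \<i>) *\<^sub>C \<i> *\<^sub>C e (S x - adj S x) = (- \<i>) *\<^sub>C \<i> *\<^sub>C (S (e x) - adj S (e x))"
      by simp
    then have I: "e (S x - adj S x) = S (e x) - adj S (e x)"
      by (simp add: scaleC_scaleC scaleC_one)
    have "2 *\<^sub>R e (S x) = e (?R x) + e (S x - adj S x)"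
      by (simp add: bounded_clinear_simps[OF be] scaleR_2)
    also have "\<dots> = 2 *\<^sub>R S (e x)" unfolding R I by (simp add: scaleR_2)
    finally show ?thesis by simp
  qed
  then have "e \<in> centre A" using e(1) by (auto simp: centre_def fun_eq_iff)
  with e(2) show False by blast
qed

text \<open>The symmetry \<open>g = 2e - 1\<close> anticommutes with \<open>y = a - gag\<close>, so it exchanges
  \<open>T + y\<close> and \<open>T - y\<close> where \<open>T\<^sup>2 = y\<^sup>2\<close>. As \<open>(T + y)(T - y) = 0\<close>, the projection \<open>p\<close> onto the
  orthogonal complement of the kernel of \<open>T + y\<close> satisfies \<open>pgp = 0\<close>.\<close>

lemma half_angle_projection:
  assumes A: "von_neumann_algebra A" and e: "e \<in> projections A" "e \<notin> centre A"
  obtains p z where "p \<in> projections A" "p z \<noteq> 0" "\<And>x. p (e (p x)) = (1/2) *\<^sub>R p x"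
proof -
  note bA = vna_bounded[OF A]
  obtain a x0 where a: "a \<in> A" "adj a = a" "e (a x0) \<noteq> a (e x0)"
    using noncommuting_self_adjoint[OF A projection_mem[OF e(1)] e(2)] by blast
  define g where "g = (\<lambda>x. 2 *\<^sub>R e x - x)"
  have gA: "g \<in> A"
    using vna_diff[OF A vna_scaleR[OF A projection_mem[OF e(1)]] vna_id[OF A]] by (simp add: g_def)
  have gg: "g (g x) = x" for x
    by (simp add: g_def bounded_clinear_simps[OF projection_bounded[OF e(1)]]
        projection_idem[OF e(1)] scaleR_2)
  have inner_g: "inner (g x) y = inner x (g y)" for x y
    by (simp add: g_def inner_diff_left inner_diff_right inner_projection[OF e(1)])
  have inner_a: "inner (a x) y = inner x (a y)" for x y
    using inner_self_adjoint[OF bA[OF a(1)] a(2)] .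
  \<comment> \<open>Twice the off-diagonal part of \<open>a\<close> relative to \<open>e\<close>,
    namely \<open>2 (e a (1 - e) + (1 - e) a e)\<close>. It vanishes exactly when \<open>a\<close>
    commutes with \<open>e\<close>.\<close>
  define y where "y = (\<lambda>x. a x - g (a (g x)))"
  have "(\<lambda>x. g (a (g x))) = g \<circ> a \<circ> g" by (simp add: fun_eq_iff)
  then have "(\<lambda>x. g (a (g x))) \<in> A" using vna_comp[OF A] gA a(1) by simp
  from vna_diff[OF A a(1) this] have yA: "y \<in> A" by (simp add: y_def)
  have inner_y: "inner (y x) z = inner x (y z)" for x z
    by (simp add: y_def inner_diff_left inner_diff_right inner_a inner_g)
  have adj_y: "adj y = y" by (rule adjI[OF bA[OF yA] bA[OF yA] inner_y])
  have gy: "g (y x) = - y (g x)" for x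
    by (simp add: y_def gg bounded_clinear_simps[OF bA[OF gA]])
  obtain T where T': "bounded_clinear T \<and> adj T = T \<and> (\<forall>x. T (T x) = y (y x)) \<and>
      (\<forall>S. bounded_linear S \<longrightarrow> (\<forall>x. S (y (y x)) = y (y (S x))) \<longrightarrow> (\<forall>x. S (T x) = T (S x)))"
    using square_root_of_square[OF bA[OF yA] adj_y] by (rule exE)
  then have T: "bounded_clinear T" "adj T = T" "\<And>x. T (T x) = y (y x)" by simp_all
  have T_comm: "S (T x) = T (S x)"
    if "bounded_linear S" "\<And>x. S (y (y x)) = y (y (S x))" for S x
    using T' that by simp
  have Tg: "g (T x) = T (g x)" for x
    using gy bounded_clinear_simps(6)[OF bA[OF yA]]
    by (intro T_comm bounded_clinearD bA gA) simp
  have Ty: "y (T x) = T (y x)" for x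
    by (intro T_comm bounded_clinearD bA yA) simp
  \<comment> \<open>The commutant of \<open>A\<close> commutes with \<open>y\<close>, hence with
    \<open>T\<close>, so the bicommutant property places \<open>T\<close> in
    \<open>A\<close>.\<close>
  have "T (S x) = S (T x)" if S: "S \<in> commutant A" for S x
    using commutantD[OF S yA] T_comm[OF bounded_clinearD[OF commutant_bounded[OF S]]] by simp
  then have "T \<in> commutant (commutant A)" by (rule commutantI[OF T(1)])
  then have TA: "T \<in> A" by (simp add: vna_bicommutant[OF A])
  define K where "K = (\<lambda>x. T x + y x)"
  define L where "L = (\<lambda>x. T x - y x)"
  have KA: "K \<in> A" unfolding K_def by (rule vna_add[OF A TA yA])
  have KL: "K (L x) = 0" for x
    by (simp add: K_def L_def bounded_clinear_simps[OF T(1)] bounded_clinear_simps[OF bA[OF yA]]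
        T(3) Ty)
  have gK: "g (K x) = L (g x)" for x
    by (simp add: K_def L_def bounded_clinear_simps[OF bA[OF gA]] Tg gy)
  have inner_L: "inner (L x) z = inner x (L z)" for x z
    by (simp add: L_def inner_diff_left inner_diff_right inner_y inner_self_adjoint[OF T(1,2)])
  obtain n where n: "n \<in> projections A" "\<And>x. n x = x \<longleftrightarrow> K x = 0"
    using kernel_projection[OF A, of "{K}"] KA by auto
  define p where "p = (\<lambda>x. x - n x)"
  have "p \<in> projections UNIV"
    unfolding p_def by (rule projection_complement[OF projection_UNIV[OF n(1)]])
  moreover have "p \<in> A"
    using vna_diff[OF A vna_id[OF A] projection_mem[OF n(1)]] by (simp add: p_def)
  ultimately have p: "p \<in> projections A" using projections_iff by blast
  note p_simps = bounded_clinear_simps[OF projection_bounded[OF p]]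
  \<comment> \<open>\<open>L\<close> maps into the kernel of \<open>K\<close>, where
    \<open>p\<close> vanishes. Being self-adjoint, \<open>L\<close> then vanishes on the range of
    \<open>p\<close>.\<close>
  have "inner (L (p x)) z = 0" for x z
  proof -
    have "n (L z) = L z" using n(2) KL by blast
    then show ?thesis
      using inner_projection[OF n(1), of x "L z"] by (simp add: p_def inner_L inner_diff_left)
  qed
  then have Lp: "L (p x) = 0" for x using inner_eq_zero_iff by blast
  \<comment> \<open>Since \<open>K g = g L\<close>, the symmetry carries the range of
    \<open>p\<close>, where \<open>L\<close> vanishes, into the kernel of \<open>K\<close>, where
    \<open>p\<close> vanishes. With \<open>g = 2e - 1\<close> this becomes
    \<open>2pep = p\<close>.\<close>
  have "p (g (p x)) = 0" for x
  proof -
    have "g (K (g (p x))) = 0" by (simp only: gK gg Lp)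
    from arg_cong[OF this, of g] have "K (g (p x)) = 0"
      by (simp only: gg bounded_clinear_simps(5)[OF bA[OF gA]])
    then have "n (g (p x)) = g (p x)" using n(2) by blast
    then show ?thesis by (simp add: p_def)
  qed
  then have "p (2 *\<^sub>R e (p x)) = p x" for x
    using p_simps by (simp add: g_def projection_idem[OF p])
  then have double: "2 *\<^sub>R p (e (p x)) = p x" for x by (simp add: p_simps)
  have half: "p (e (p x)) = (1/2) *\<^sub>R p x" for x
    using arg_cong[OF double, of "\<lambda>v. (1/2) *\<^sub>R v" x] by simp
  \<comment> \<open>If \<open>p = 0\<close> then \<open>K = 0\<close>, so also
    \<open>L = g K g = 0\<close> and \<open>2y = K - L = 0\<close>, against the choice of
    \<open>a\<close>.\<close>
  have "\<exists>z. p z \<noteq> 0"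
  proof (rule ccontr)
    assume "\<not> ?thesis"
    then have "K x = 0" for x using n(2) by (simp add: p_def)
    moreover from this have "L x = 0" for x
      using gK[of "g x"] gg bounded_clinear_simps(5)[OF bA[OF gA]] by simp
    ultimately have "T x + y x = 0" "T x - y x = 0" for x by (simp_all add: K_def L_def)
    moreover have "2 *\<^sub>R y x = (T x + y x) - (T x - y x)" for x by (simp add: scaleR_2)
    ultimately have "y x = 0" for x by simp
    from this[of x0] have "a x0 = g (a (g x0))" by (simp only: y_def right_minus_eq)
    then have "g (a x0) = g (g (a (g x0)))" by (rule arg_cong)
    then have "g (a x0) = a (g x0)" by (simp only: gg)
    then have "e (a x0) = a (e x0)" by (simp add: g_def bounded_clinear_simps[OF bA[OF a(1)]])
    with a(3) show False by blast
  qed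
  then show ?thesis using p half that by blast
qed

text \<open>From \<open>pep = p/2\<close> it follows that \<open>2epe\<close> and \<open>2(1-e)p(1-e)\<close> are projections, exchanged by
  the unitary \<open>1 - 2p\<close>.\<close>

lemma unitary_into_complement:
  assumes A: "von_neumann_algebra A" and e: "e \<in> projections A" "e \<notin> centre A"
  obtains u s z where "u \<in> A" "unitary_op u" "s \<in> projections A" "s \<preceq> e"
    "conjugate_op u s z \<noteq> 0" "\<And>x. e (conjugate_op u s x) = 0"
proof -
  obtain p z where p: "p \<in> projections A" "p z \<noteq> 0" "\<And>x. p (e (p x)) = (1/2) *\<^sub>R p x"
    using half_angle_projection[OF A e] by blast
  note p_simps = bounded_clinear_simps[OF projection_bounded[OF p(1)]] projection_idem[OF p(1)]
  note e_simps = bounded_clinear_simps[OF projection_bounded[OF e(1)]] projection_idem[OF e(1)]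
  note mem = projection_mem[OF p(1)] projection_mem[OF e(1)]
  define u where "u = (\<lambda>x. x - 2 *\<^sub>R p x)"
  have uA: "u \<in> A"
    using vna_diff[OF A vna_id[OF A] vna_scaleR[OF A mem(1)]] by (simp add: u_def)
  have adj_u: "adj u = u"
    using vna_bounded[OF A uA]
    by (intro adjI) (simp_all add: u_def inner_diff_left inner_diff_right inner_projection[OF p(1)])
  have uu: "u (u x) = x" for x
    by (simp add: u_def p_simps scaleR_2)
  have u: "unitary_op u"
    using vna_bounded[OF A uA] by (simp add: unitary_op_def adj_u fun_eq_iff uu)
  define s where "s = (\<lambda>x. 2 *\<^sub>R e (p (e x)))"
  have "(\<lambda>x. e (p (e x))) = e \<circ> p \<circ> e" by (simp add: fun_eq_iff)
  then have sA: "s \<in> A"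
    using vna_scaleR[OF A vna_comp[OF A vna_comp[OF A mem(2,1)] mem(2)], of 2]
    by (simp add: s_def fun_eq_iff)
  have sU: "s \<in> projections UNIV"
  proof (rule projectionI)
    show "bounded_clinear s" using vna_bounded[OF A sA] .
    show "s (s x) = s x" for x by (simp add: s_def e_simps p_simps p(3))
    show "inner (s x) y = inner x (s y)" for x y
      by (simp add: s_def inner_projection[OF e(1)] inner_projection[OF p(1)])
  qed
  then have "s \<in> projections A" using sA projections_iff by blast
  moreover have "s \<preceq> e"
    using sU projection_UNIV[OF e(1)] by (simp add: projection_le_iff s_def e_simps)
  \<comment> \<open>The right-hand side is \<open>2 (1 - e) p (1 - e) x\<close>, since
    \<open>w = - p (1 - e) x\<close>. As \<open>w\<close> lies in the range of \<open>p\<close>, the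
    relation \<open>pep = p/2\<close> applies to it.\<close>
  moreover have r: "conjugate_op u s x = 2 *\<^sub>R (e (p (e x) - p x) - (p (e x) - p x))" for x
  proof -
    define w where "w = p (e x) - p x"
    have "p w = w" by (simp add: w_def p_simps)
    have "s (u x) = 2 *\<^sub>R e w" by (simp add: s_def u_def w_def e_simps p_simps p(3))
    moreover have "p (e w) = (1/2) *\<^sub>R w" using p(3)[of w] by (simp only: \<open>p w = w\<close>)
    ultimately have "u (s (u x)) = 2 *\<^sub>R (e w - w)"
      by (simp add: u_def p_simps scaleR_diff_right)
    then show ?thesis by (simp add: adj_u w_def)
  qed
  \<comment> \<open>Tested on \<open>p z\<close>: vanishing there would give
    \<open>e (p z) = p z\<close>, and then \<open>p z = p (e (p z))\<close> would be half of
    itself.\<close>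
  moreover have "\<exists>z. conjugate_op u s z \<noteq> 0"
  proof (rule ccontr)
    assume "\<not> ?thesis"
    then have "conjugate_op u s (p z) = 0" by blast
    then have "e (p (e (p z)) - p (p z)) - (p (e (p z)) - p (p z)) = 0"
      unfolding r by (metis scaleR_eq_0_iff zero_neq_numeral)
    moreover have "p (e (p z)) - p (p z) = (1/2 - 1) *\<^sub>R p z"
      by (simp only: p_simps p(3) scaleR_left_diff_distrib scaleR_one)
    ultimately have "e (p z) = p z" by (simp add: e_simps)
    then have "p z = (1/2) *\<^sub>R p z" using p(3)[of z] by (simp add: p_simps)
    from arg_cong[OF this, of "inner (p z)"] have "inner (p z) (p z) = 0"
      unfolding inner_scaleR_right by linarith
    then show False using p(2) by simp
  qed
  moreover have "e (conjugate_op u s x) = 0" for x unfolding r by (simp add: e_simps)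
  ultimately show ?thesis using that[OF uA u] by blast
qed


section \<open>Consistent and invariant families\<close>

lemma comm_subalgebra_projection:
  assumes "V \<in> comm_subalgebras A" "p \<in> projections V"
  shows "p \<in> projections A"
  using assms comm_subalgebrasD(1)[OF assms(1)] by (auto simp: projections_def)

lemma
  assumes "consistent_family A \<Phi>" "V \<in> comm_subalgebras A"
  shows consistent_family_projection: "\<Phi> V \<in> projections V"
    and consistent_family_largest:
      "V' \<in> comm_subalgebras A \<Longrightarrow> V \<subseteq> V' \<Longrightarrow> is_largest_projection_below V (\<Phi> V') (\<Phi> V)"
  using assms unfolding consistent_family_def by blast+

lemma consistent_family_mono:
  assumes "consistent_family A \<Phi>" "V \<in> comm_subalgebras A" "V' \<in> comm_subalgebras A" "V \<subseteq> V'"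
  shows "\<Phi> V \<preceq> \<Phi> V'"
  using consistent_family_largest[OF assms] by (simp add: is_largest_projection_below_def)

section \<open>Projections dominated by a family\<close>

text \<open>For \<open>\<Phi> = \<Phi>\<^sub>p\<close> these are the projections of \<open>A\<close> below \<open>p\<close>.\<close>

definition dominated_projections ::
    "('h::complex_hilbert \<Rightarrow> 'h) set \<Rightarrow> (('h \<Rightarrow> 'h) set \<Rightarrow> ('h \<Rightarrow> 'h)) \<Rightarrow> ('h \<Rightarrow> 'h) set" where
  "dominated_projections A \<Phi> = {q. \<exists>V\<in>comm_subalgebras A. q \<in> projections V \<and> q \<preceq> \<Phi> V}"

lemma dominated_projectionsI:
  "V \<in> comm_subalgebras A \<Longrightarrow> q \<in> projections V \<Longrightarrow> q \<preceq> \<Phi> V \<Longrightarrow> q \<in> dominated_projections A \<Phi>"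
  unfolding dominated_projections_def by blast

lemma dominated_projections_subset: "dominated_projections A \<Phi> \<subseteq> projections A"
  unfolding dominated_projections_def using comm_subalgebra_projection by blast

text \<open>The algebra \<open>U\<close> generated by \<open>q\<close> lies in every commutative
  subalgebra containing \<open>q\<close>. Consistency brings domination by \<open>\<Phi> V\<close>
  down to \<open>\<Phi> U\<close>, and monotonicity takes it up to \<open>\<Phi> W\<close>.\<close>

lemma dominated_projection_le:
  assumes A: "von_neumann_algebra A" and \<Phi>: "consistent_family A \<Phi>"
    and q: "q \<in> dominated_projections A \<Phi>" and W: "W \<in> comm_subalgebras A" "q \<in> W"
  shows "q \<preceq> \<Phi> W"
proof -
  obtain V where V: "V \<in> comm_subalgebras A" "q \<in> projections V" "q \<preceq> \<Phi> V"
    using q unfolding dominated_projections_def by blast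
  have qA: "q \<in> projections A" using q dominated_projections_subset by blast
  define U where "U = commutant (commutant {q})"
  have U: "U \<in> comm_subalgebras A" "q \<in> U"
    using generated_comm_subalgebra_projections[OF A, of "{q}"] qA by (auto simp: U_def)
  have sub: "U \<subseteq> X" if "X \<in> comm_subalgebras A" "q \<in> X" for X
  proof -
    have "U \<subseteq> commutant (commutant X)"
      unfolding U_def using that(2) by (intro commutant_antimono) simp
    then show ?thesis by (simp only: vna_bicommutant[OF comm_subalgebrasD(2)[OF that(1)]])
  qed
  have "q \<in> projections U"
    using U(2) projection_UNIV[OF qA] by (subst projections_iff) simp
  then have "q \<preceq> \<Phi> U"
    using consistent_family_largest[OF \<Phi> U(1) V(1) sub[OF V(1) projection_mem[OF V(2)]]] V(3)
    unfolding is_largest_projection_below_def by blast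
  moreover have "\<Phi> U \<preceq> \<Phi> W" using \<Phi> U(1) W(1) sub[OF W] by (rule consistent_family_mono)
  ultimately show ?thesis
    using projection_le_trans[OF projection_UNIV[OF qA]
        projection_UNIV[OF consistent_family_projection[OF \<Phi> U(1)]]
        projection_UNIV[OF consistent_family_projection[OF \<Phi> W(1)]]]
    by blast
qed

text \<open>Since \<open>s\<close> commutes with \<open>q\<close>, one commutative subalgebra
  \<open>W\<close> contains both, and there \<open>s \<preceq> q \<preceq> \<Phi> W\<close>.\<close>

lemma dominated_projection_downward:
  assumes A: "von_neumann_algebra A" and \<Phi>: "consistent_family A \<Phi>"
    and q: "q \<in> dominated_projections A \<Phi>" and s: "s \<in> projections A" "s \<preceq> q"
  shows "s \<in> dominated_projections A \<Phi>"
proof -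
  have qA: "q \<in> projections A" using q dominated_projections_subset by blast
  note U = projection_UNIV[OF s(1)] projection_UNIV[OF qA]
  have "s \<circ> q = q \<circ> s"
    using s(2) projection_le_iff[OF U] projection_le_iff'[OF U] by (simp add: fun_eq_iff)
  then have comm: "S \<circ> T = T \<circ> S" if "S \<in> {q, s}" "T \<in> {q, s}" for S T using that by auto
  define W where "W = commutant (commutant {q, s})"
  have "{q, s} \<subseteq> projections A" using qA s(1) by blast
  then have W: "W \<in> comm_subalgebras A" and sub: "{q, s} \<subseteq> W"
    using generated_comm_subalgebra_projections[OF A _ comm] unfolding W_def by blast+
  have "q \<preceq> \<Phi> W" using dominated_projection_le[OF A \<Phi> q W] sub by blast
  then have "s \<preceq> \<Phi> W"
    using projection_le_trans[OF U projection_UNIV[OF consistent_family_projection[OF \<Phi> W]] s(2)]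
    by blast
  moreover have "s \<in> projections W" using sub U(1) by (subst projections_iff) simp
  ultimately show ?thesis using W by (intro dominated_projectionsI)
qed

text \<open>The conjugation equation of an invariant family enters the argument for centrality only
  here.\<close>

lemma dominated_projection_conjugate:
  assumes A: "von_neumann_algebra A" and \<Phi>: "invariant_family A \<Phi>"
    and q: "q \<in> dominated_projections A \<Phi>" and u: "u \<in> A" "unitary_op u"
  shows "conjugate_op u q \<in> dominated_projections A \<Phi>"
proof -
  have c: "consistent_family A \<Phi>" using \<Phi> by (simp add: invariant_family_def)
  obtain V where V: "V \<in> comm_subalgebras A" "q \<in> projections V" "q \<preceq> \<Phi> V"
    using q unfolding dominated_projections_def by blast
  have "conjugate_op u q \<preceq> conjugate_op u (\<Phi> V)"
    using u(2) projection_UNIV[OF V(2)] projection_UNIV[OF consistent_family_projection[OF c V(1)]] V(3)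
    by (rule conjugate_op_mono)
  also have "conjugate_op u (\<Phi> V) = \<Phi> (conjugate_op u ` V)"
    using \<Phi> V(1) u by (simp add: invariant_family_def)
  finally have "conjugate_op u q \<preceq> \<Phi> (conjugate_op u ` V)" .
  moreover have "conjugate_op u q \<in> projections (conjugate_op u ` V)"
    using V(2) projections_conjugate[OF u(2)] by blast
  ultimately show ?thesis
    using conjugate_comm_subalgebra[OF A u V(1)] by (intro dominated_projectionsI)
qed

text \<open>Zorn's lemma is applied to the commuting sets of dominated projections. A maximal one
  generates a commutative subalgebra \<open>W\<close>, and \<open>\<Phi> W\<close> lies above all its members.\<close>

lemma maximal_dominated_projection:
  assumes A: "von_neumann_algebra A" and \<Phi>: "consistent_family A \<Phi>"
    and q: "q \<in> dominated_projections A \<Phi>"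
  obtains e where "e \<in> dominated_projections A \<Phi>" "q \<preceq> e"
    "\<And>r x. r \<in> dominated_projections A \<Phi> \<Longrightarrow> (\<And>x. e (r x) = 0) \<Longrightarrow> r x = 0"
proof -
  let ?D = "dominated_projections A \<Phi>"
  have DU: "p \<in> projections UNIV" if "p \<in> ?D" for p
    using that dominated_projections_subset projection_UNIV by blast
  define comm :: "('a \<Rightarrow> 'a) set \<Rightarrow> bool" where
    "comm C \<longleftrightarrow> (\<forall>S\<in>C. \<forall>T\<in>C. \<forall>x. S (T x) = T (S x))" for C
  \<comment> \<open>Requiring \<open>insert q C\<close> to commute, instead of
    \<open>q \<in> C\<close>, keeps the empty set in \<open>F\<close>, as the union of the empty
    chain demands. Maximality then puts \<open>q\<close> into \<open>M\<close>.\<close>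
  define F where "F = {C. C \<subseteq> ?D \<and> comm (insert q C)}"
  have "\<exists>M\<in>F. \<forall>X\<in>F. M \<subseteq> X \<longrightarrow> X = M"
  proof (rule subset_Zorn')
    fix \<C> assume "subset.chain F \<C>"
    then have ch: "\<C> \<subseteq> F" "\<And>X Y. X \<in> \<C> \<Longrightarrow> Y \<in> \<C> \<Longrightarrow> X \<subseteq> Y \<or> Y \<subseteq> X"
      by (auto simp: subset_chain_def)
    have "S (T x) = T (S x)" if S: "S \<in> insert q (\<Union>\<C>)" and T: "T \<in> insert q (\<Union>\<C>)" for S T x
    proof (cases "S = q \<and> T = q")
      case False
      then obtain X where X: "X \<in> \<C>" "S \<in> insert q X" "T \<in> insert q X"
        using S T ch(2) by blast
      then have "comm (insert q X)" using ch(1) by (auto simp: F_def)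
      then show ?thesis using X(2,3) unfolding comm_def by blast
    qed simp
    then have "comm (insert q (\<Union>\<C>))" unfolding comm_def by blast
    moreover have "\<Union>\<C> \<subseteq> ?D" using ch(1) unfolding F_def by blast
    ultimately show "\<Union>\<C> \<in> F" unfolding F_def by blast
  qed
  then obtain M where M: "M \<in> F" and max: "\<And>X. X \<in> F \<Longrightarrow> M \<subseteq> X \<Longrightarrow> X = M" by blast
  have MD: "M \<subseteq> ?D" and commM: "comm (insert q M)" using M by (auto simp: F_def)
  have "insert q M \<in> F" using MD commM q by (simp add: F_def)
  then have qM: "q \<in> M" using max by blast
  define W where "W = commutant (commutant M)"
  have "M \<subseteq> projections A" using MD dominated_projections_subset by blast
  moreover have "S \<circ> T = T \<circ> S" if "S \<in> M" "T \<in> M" for S T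
    using that commM unfolding comm_def by (auto simp: fun_eq_iff)
  ultimately have W: "W \<in> comm_subalgebras A" and MW: "M \<subseteq> W"
    unfolding W_def using generated_comm_subalgebra_projections[OF A] by blast+
  \<comment> \<open>A value of \<open>\<Phi>\<close> is dominated by itself, so no separate argument
    about the supremum of \<open>M\<close> is involved.\<close>
  define e where "e = \<Phi> W"
  have eW: "e \<in> projections W" unfolding e_def by (rule consistent_family_projection[OF \<Phi> W])
  note eU = projection_UNIV[OF eW]
  have "e \<preceq> \<Phi> W" unfolding e_def by (rule projection_le_refl[OF eU[unfolded e_def]])
  with W eW have "e \<in> ?D" by (rule dominated_projectionsI)
  moreover have le: "c \<preceq> e" if "c \<in> M" for c
    unfolding e_def using dominated_projection_le[OF A \<Phi> _ W] that MD MW by blast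
  \<comment> \<open>A dominated \<open>r\<close> orthogonal to \<open>e\<close> is orthogonal to
    every member of \<open>M\<close>, hence commutes with them all. Maximality gives
    \<open>r \<in> M\<close>, so \<open>r\<close> is below \<open>e\<close> as well and
    vanishes.\<close>
  moreover have "r x = 0" if r: "r \<in> ?D" and er: "\<And>x. e (r x) = 0" for r x
  proof -
    note rU = DU[OF r]
    have "inner (r (e x)) z = 0" for x z
      by (simp add: inner_projection[OF rU] inner_projection[OF eW] er)
    then have re: "r (e x) = 0" for x using inner_eq_zero_iff by blast
    have "c (r x) = 0 \<and> r (c x) = 0" if c: "c \<in> M" for c x
    proof -
      have cU: "c \<in> projections UNIV" using c MD DU by blast
      have "e (c x) = c x" using le[OF c] projection_le_iff[OF cU eU] by simp
      then have "r (c x) = 0" using re[of "c x"] by simp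
      moreover have "c (e (r x)) = c (r x)" using le[OF c] projection_le_iff'[OF cU eU] by simp
      then have "c (r x) = 0"
        using er bounded_clinear_simps(5)[OF projection_bounded[OF cU]] by simp
      ultimately show ?thesis by blast
    qed
    then have "comm (insert r M)"
      using commM unfolding comm_def by auto
    then have "insert r M \<in> F" using MD qM r by (simp add: F_def insert_absorb insert_commute)
    then have "r \<in> M" using max by blast
    then have "e (r x) = r x" using le projection_le_iff[OF rU eU] by blast
    then show ?thesis using er by simp
  qed
  ultimately show ?thesis using that le[OF qM] by blast
qed

lemma dominated_projection_le_centre:
  assumes A: "von_neumann_algebra A" and \<Phi>: "invariant_family A \<Phi>"
    and q: "q \<in> dominated_projections A \<Phi>"
  shows "q \<preceq> \<Phi> (centre A)"
proof -
  let ?D = "dominated_projections A \<Phi>"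
  have c: "consistent_family A \<Phi>" using \<Phi> by (simp add: invariant_family_def)
  obtain e where e: "e \<in> ?D" "q \<preceq> e"
    and max: "\<And>r x. r \<in> ?D \<Longrightarrow> (\<And>x. e (r x) = 0) \<Longrightarrow> r x = 0"
    using maximal_dominated_projection[OF A c q] by metis
  have eA: "e \<in> projections A" using e(1) dominated_projections_subset by blast
  have "e \<in> centre A"
  proof (rule ccontr)
    assume "e \<notin> centre A"
    then obtain u s z where u: "u \<in> A" "unitary_op u" and s: "s \<in> projections A" "s \<preceq> e"
      and z: "conjugate_op u s z \<noteq> 0" "\<And>x. e (conjugate_op u s x) = 0"
      using unitary_into_complement[OF A eA] by metis
    have "s \<in> ?D" using A c e(1) s by (rule dominated_projection_downward)
    with A \<Phi> have "conjugate_op u s \<in> ?D" using u by (rule dominated_projection_conjugate)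
    then have "conjugate_op u s z = 0" using z(2) by (rule max)
    with z(1) show False by blast
  qed
  note Z = centre_mem_comm_subalgebras[OF A]
  \<comment> \<open>Centrality of \<open>e\<close> is what allows the centre to serve as the
    subalgebra containing it.\<close>
  have "e \<preceq> \<Phi> (centre A)" by (rule dominated_projection_le[OF A c e(1) Z \<open>e \<in> centre A\<close>])
  then show ?thesis
    using projection_le_trans[OF _ projection_UNIV[OF eA]
        projection_UNIV[OF consistent_family_projection[OF c Z]] e(2)]
      q dominated_projections_subset projection_UNIV by blast
qed

text \<open>As \<open>V\<close> may fail to contain the centre, the value is compared on the algebra
  \<open>W\<close> generated by both. There \<open>\<Phi> W = \<Phi> (centre A)\<close>, and
  consistency along \<open>V \<subseteq> W\<close> gives the claim.\<close>

lemma invariant_family_largest: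
  assumes A: "von_neumann_algebra A" and \<Phi>: "invariant_family A \<Phi>"
    and V: "V \<in> comm_subalgebras A"
  shows "is_largest_projection_below V (\<Phi> (centre A)) (\<Phi> V)"
proof -
  have c: "consistent_family A \<Phi>" using \<Phi> by (simp add: invariant_family_def)
  note Z = centre_mem_comm_subalgebras[OF A]
  note V' = comm_subalgebrasD[OF V] and Z' = comm_subalgebrasD[OF Z]
  define W where "W = commutant (commutant (V \<union> centre A))"
  have "S \<circ> T = T \<circ> S" if "S \<in> V \<union> centre A" "T \<in> V \<union> centre A" for S T
    using that V'(1,3) unfolding centre_def by (auto simp: subset_iff)
  then have W: "W \<in> comm_subalgebras A" "V \<union> centre A \<subseteq> W"
    unfolding W_def
    using generated_comm_subalgebra[OF A, of "V \<union> centre A"] V'(1) Z'(1)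
      vna_adj[OF V'(2)] vna_adj[OF Z'(2)] by blast+
  note WU = projection_UNIV[OF consistent_family_projection[OF c W(1)]]
    and ZU = projection_UNIV[OF consistent_family_projection[OF c Z]]
  have "\<Phi> W \<in> dominated_projections A \<Phi>"
    using W(1) consistent_family_projection[OF c W(1)] projection_le_refl[OF WU]
    by (rule dominated_projectionsI)
  then have "\<Phi> W \<preceq> \<Phi> (centre A)" by (rule dominated_projection_le_centre[OF A \<Phi>])
  moreover have "\<Phi> (centre A) \<preceq> \<Phi> W"
    using W(2) by (intro consistent_family_mono[OF c Z W(1)]) simp
  ultimately have "\<Phi> W = \<Phi> (centre A)" by (rule projection_le_antisym[OF WU ZU])
  then show ?thesis using consistent_family_largest[OF c V W(1)] W(2) by simp
qed

section \<open>The correspondence between central projections and invariant families\<close>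

lemma induced_family_of_invariant:
  assumes A: "von_neumann_algebra A" and \<Phi>: "invariant_family A \<Phi>"
  shows "induced_family A (\<Phi> (centre A)) = \<Phi>"
proof
  fix V
  show "induced_family A (\<Phi> (centre A)) V = \<Phi> V"
  proof (cases "V \<in> comm_subalgebras A")
    case True
    then show ?thesis by (rule induced_family_eq[OF _ invariant_family_largest[OF A \<Phi> True]])
  next
    \<comment> \<open>Outside \<open>comm_subalgebras A\<close> both families take the value
      \<open>undefined\<close>, so the equality is one of functions.\<close>
    case False
    moreover have "\<Phi> \<in> (\<Pi>\<^sub>E V\<in>comm_subalgebras A. projections V)"
      using \<Phi> by (simp add: invariant_family_def consistent_family_def)
    ultimately have "\<Phi> V = undefined" by (rule PiE_arb[rotated])
    with False show ?thesis by (simp add: induced_family_def)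
  qed
qed

text \<open>For \<open>V \<subseteq> V'\<close>, a projection of \<open>V\<close> is below
  \<open>p\<close> exactly when it is below the largest projection of \<open>V'\<close> under
  \<open>p\<close>.\<close>

lemma consistent_induced_family:
  assumes p: "p \<in> projections UNIV"
  shows "consistent_family A (induced_family A p)"
  unfolding consistent_family_def
proof (intro conjI ballI impI)
  note largest = induced_family_largest[OF _ p, unfolded is_largest_projection_below_def]
  show "induced_family A p \<in> (\<Pi>\<^sub>E V\<in>comm_subalgebras A. projections V)"
  proof (rule PiE_I)
    show "induced_family A p V \<in> projections V" if "V \<in> comm_subalgebras A" for V
      using largest[OF that] by blast
    show "induced_family A p V = undefined" if "V \<notin> comm_subalgebras A" for V
      using that by (simp add: induced_family_def)
  qed
  fix V V' assume V: "V \<in> comm_subalgebras A" and V': "V' \<in> comm_subalgebras A" and sub: "V \<subseteq> V'"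
  let ?q = "induced_family A p V" and ?q' = "induced_family A p V'"
  have q: "?q \<in> projections V" "?q \<preceq> p" "\<And>r. r \<in> projections V \<Longrightarrow> r \<preceq> p \<Longrightarrow> r \<preceq> ?q"
    using largest[OF V] by blast+
  have q': "?q' \<in> projections V'" "?q' \<preceq> p" "\<And>r. r \<in> projections V' \<Longrightarrow> r \<preceq> p \<Longrightarrow> r \<preceq> ?q'"
    using largest[OF V'] by blast+
  have "?q \<in> projections V'" using q(1) sub by (auto simp: projections_def)
  then have "?q \<preceq> ?q'" using q(2) by (rule q'(3))
  moreover have "r \<preceq> ?q" if r: "r \<in> projections V" "r \<preceq> ?q'" for r
    using r(1) projection_le_trans[OF projection_UNIV[OF r(1)] projection_UNIV[OF q'(1)] p r(2) q'(2)]
    by (rule q(3))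
  ultimately show "is_largest_projection_below V ?q' ?q"
    using q(1) by (simp add: is_largest_projection_below_def)
qed

text \<open>A central \<open>z\<close> is fixed by conjugation with \<open>u\<close>, so conjugation
  carries the largest projection of \<open>V\<close> below \<open>z\<close> to the largest one of
  the conjugated algebra below the same \<open>z\<close>.\<close>

lemma invariant_induced_family:
  assumes A: "von_neumann_algebra A" and z: "z \<in> projections (centre A)"
  shows "invariant_family A (induced_family A z)"
  unfolding invariant_family_def
proof (intro conjI ballI impI)
  note zU = projection_UNIV[OF z]
  show "consistent_family A (induced_family A z)" by (rule consistent_induced_family[OF zU])
  fix V u assume V: "V \<in> comm_subalgebras A" and u: "u \<in> A" "unitary_op u"
  have "z (u x) = u (z x)" for x
    using projection_mem[OF z] u(1) by (simp add: centre_def fun_eq_iff)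
  then have "u (z (adj u x)) = z x" for x
    using unitary_adj_right[OF u(2)] by metis
  then have "conjugate_op u z = z" by (simp add: fun_eq_iff)
  then have "is_largest_projection_below (conjugate_op u ` V) z (conjugate_op u (induced_family A z V))"
    using largest_projection_conjugate[OF u(2) zU induced_family_largest[OF V zU]] by simp
  then show "induced_family A z (conjugate_op u ` V) = conjugate_op u (induced_family A z V)"
    by (rule induced_family_eq[OF conjugate_comm_subalgebra[OF A u V]])
qed

lemma induced_family_centre:
  assumes A: "von_neumann_algebra A" and z: "z \<in> projections (centre A)"
  shows "induced_family A z (centre A) = z"
proof (rule induced_family_eq[OF centre_mem_comm_subalgebras[OF A]])
  show "is_largest_projection_below (centre A) z z"
    using z projection_le_refl[OF projection_UNIV[OF z]]
    unfolding is_largest_projection_below_def by blast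
qed

theorem theorem1p7:
  fixes A :: "('h::complex_hilbert \<Rightarrow> 'h) set"
  assumes "von_neumann_algebra A"
  shows "(\<forall>\<Phi>. consistent_family A \<Phi> \<longrightarrow>
            ((\<exists>z\<in>projections (centre A). \<Phi> = induced_family A z) \<longleftrightarrow> invariant_family A \<Phi>)) \<and>
         bij_betw (induced_family A) (projections (centre A)) {\<Phi>. invariant_family A \<Phi>} \<and>
         bij_betw (\<lambda>\<Phi>. \<Phi> (centre A)) {\<Phi>. invariant_family A \<Phi>} (projections (centre A)) \<and>
         (\<forall>z\<in>projections (centre A). induced_family A z (centre A) = z) \<and>
         (\<forall>\<Phi>. invariant_family A \<Phi> \<longrightarrow> induced_family A (\<Phi> (centre A)) = \<Phi>)"
proof -
  let ?I = "{\<Phi>. invariant_family A \<Phi>}" and ?Z = "projections (centre A)"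
  have inv: "induced_family A z \<in> ?I" if "z \<in> ?Z" for z
    using invariant_induced_family[OF assms that] by simp
  have cen: "\<Phi> (centre A) \<in> ?Z" if "\<Phi> \<in> ?I" for \<Phi>
    using that consistent_family_projection[OF _ centre_mem_comm_subalgebras[OF assms]]
    by (simp add: invariant_family_def)
  have left: "induced_family A z (centre A) = z" if "z \<in> ?Z" for z
    using induced_family_centre[OF assms that] .
  have right: "induced_family A (\<Phi> (centre A)) = \<Phi>" if "\<Phi> \<in> ?I" for \<Phi>
    using induced_family_of_invariant[OF assms] that by simp
  have "(\<exists>z\<in>?Z. \<Phi> = induced_family A z) \<longleftrightarrow> invariant_family A \<Phi>" for \<Phi>
  proof
    assume "\<exists>z\<in>?Z. \<Phi> = induced_family A z"
    then show "invariant_family A \<Phi>" using inv by auto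
  next
    assume "invariant_family A \<Phi>"
    then have "\<Phi> (centre A) \<in> ?Z" "\<Phi> = induced_family A (\<Phi> (centre A))"
      using cen right by simp_all
    then show "\<exists>z\<in>?Z. \<Phi> = induced_family A z" by (intro bexI[where x = "\<Phi> (centre A)"])
  qed
  moreover have "bij_betw (induced_family A) ?Z ?I"
    using left right inv cen
    by (intro bij_betw_byWitness[where f' = "\<lambda>\<Phi>. \<Phi> (centre A)"]) blast+
  moreover have "bij_betw (\<lambda>\<Phi>. \<Phi> (centre A)) ?I ?Z"
    using left right inv cen
    by (intro bij_betw_byWitness[where f' = "induced_family A"]) blast+
  ultimately show ?thesis using left right by blast
qed

end
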